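(* Let $(p_k)_{k\in\mathbb{N}}$ be a probability sequence and let $\rho\geq 1$. Suppose that $(p_k)_{k\in\mathbb{N}}$ is regularly varying with tail index $\rho$. Then for any $0<\theta\leq 1$, $$\dim\left\{x\in[0,1):\lim_{n\to+\infty}\frac{D_n(x)}{n}=\theta\right\}=\frac{1}{\rho}.$$
   Context: $\mathbb{N}=\{1,2,3,\ldots\}$, $\mathbb{R}^+=(0,\infty)$, and $\dim$ denotes Hausdorff dimension. A probability sequence is a sequence $(p_k)_{k\in\mathbb{N}}$ with $p_k>0$ for every $k$ and $\sum_{k\in\mathbb{N}}p_k=1$. It is regularly varying with tail index $\rho\geq1$ if there exists a slowly varying function $L:\mathbb{N}\to\mathbb{R}^+$ (i.e. $\lim_{k\to\infty}L(\lfloor\lambda k\rfloor)/L(k)=1$ for every $\lambda>0$) such that $\lim_{k\to+\infty}p_k/(k^{-\rho}L(k))=1$. Setting: $(I_k)_{k\in\mathbb{N}}$ is a partition of $[0,1)$ into pairwise disjoint half-open intervals (of the form $[a,b)$) with $\operatorname{diam} I_k=p_k$ for every $k$. The full-branch map $T:[0,1)\to[0,1)$ is $T(x)=(x-\inf I_k)/p_k$ for $x\in I_k$. For $n\in\mathbb{N}$, the digit function $d_n:[0,1)\to\mathbb{N}$ is defined by $d_n(x)=k$ if $T^{n-1}(x)\in I_k$. The distinct-digit count is $D_n(x)=\#\{d_1(x),\ldots,d_n(x)\}$. *)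

theory Defs
  imports "HOL-Analysis.Analysis"
begin

section \<open>Hausdorff measure and dimension\<close>

text \<open>
  In Isabelle \<open>0 powr 0 = 0\<close>, and \<open>diameter\<close> is meaningful only on bounded sets. The usual
  conventions \<open>(diam {})^s = 0\<close> and \<open>(diam U)^0 = 1\<close> for nonempty \<open>U\<close> are therefore
  made explicit, and the covers below consist of bounded sets.
\<close>

definition diam_pow :: "real \<Rightarrow> 'a::metric_space set \<Rightarrow> ennreal" where
  "diam_pow s U = (if U = {} then 0 else if s = 0 then 1 else ennreal (diameter U powr s))"

definition delta_covers :: "real \<Rightarrow> 'a::metric_space set \<Rightarrow> (nat \<Rightarrow> 'a set) set" where
  "delta_covers \<delta> A = {U. A \<subseteq> (\<Union>i. U i) \<and> (\<forall>i. bounded (U i) \<and> diameter (U i) \<le> \<delta>)}"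

definition hausdorff_pre :: "real \<Rightarrow> real \<Rightarrow> 'a::metric_space set \<Rightarrow> ennreal" where
  "hausdorff_pre s \<delta> A = (INF U \<in> delta_covers \<delta> A. \<Sum>i. diam_pow s (U i))"

definition hausdorff_measure :: "real \<Rightarrow> 'a::metric_space set \<Rightarrow> ennreal" where
  "hausdorff_measure s A = (SUP \<delta> \<in> {0<..}. hausdorff_pre s \<delta> A)"

definition hausdorff_dim :: "'a::metric_space set \<Rightarrow> ennreal" where
  "hausdorff_dim A = (INF s \<in> {s. 0 \<le> s \<and> hausdorff_measure s A = 0}. ennreal s)"


section \<open>Regularly varying probability sequences\<close>

text \<open>
  All sequences are indexed by the positive integers. They are represented as functions on
  \<^typ>\<open>nat\<close> whose value at \<open>0\<close> is irrelevant.
\<close>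

definition probability_sequence :: "(nat \<Rightarrow> real) \<Rightarrow> bool" where
  "probability_sequence p \<longleftrightarrow> (\<forall>k\<ge>1. p k > 0) \<and> (p has_sum 1) {1..}"

definition slowly_varying :: "(nat \<Rightarrow> real) \<Rightarrow> bool" where
  "slowly_varying L \<longleftrightarrow> (\<forall>k\<ge>1. L k > 0) \<and>
     (\<forall>l>0. (\<lambda>k. L (nat \<lfloor>l * real k\<rfloor>) / L k) \<longlonglongrightarrow> 1)"

definition regularly_varying :: "(nat \<Rightarrow> real) \<Rightarrow> real \<Rightarrow> bool" where
  "regularly_varying p \<rho> \<longleftrightarrow>
     (\<exists>L. slowly_varying L \<and> (\<lambda>k. p k / (real k powr (- \<rho>) * L k)) \<longlonglongrightarrow> 1)"


section \<open>Full-branch maps and digits\<close>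

definition interval_partition :: "(nat \<Rightarrow> real) \<Rightarrow> (nat \<Rightarrow> real set) \<Rightarrow> bool" where
  "interval_partition p I \<longleftrightarrow>
     (\<forall>k\<ge>1. (\<exists>a b. I k = {a..<b}) \<and> diameter (I k) = p k) \<and>
     disjoint_family_on I {1..} \<and> (\<Union>k\<in>{1..}. I k) = {0..<1}"

definition branch :: "(nat \<Rightarrow> real set) \<Rightarrow> real \<Rightarrow> nat" where
  "branch I x = (THE k. k \<ge> 1 \<and> x \<in> I k)"

definition full_branch_map :: "(nat \<Rightarrow> real) \<Rightarrow> (nat \<Rightarrow> real set) \<Rightarrow> real \<Rightarrow> real" where
  "full_branch_map p I x = (x - Inf (I (branch I x))) / p (branch I x)"

definition digit :: "(nat \<Rightarrow> real) \<Rightarrow> (nat \<Rightarrow> real set) \<Rightarrow> nat \<Rightarrow> real \<Rightarrow> nat" where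
  "digit p I n x = branch I ((full_branch_map p I ^^ (n - 1)) x)"

definition distinct_digits :: "(nat \<Rightarrow> real) \<Rightarrow> (nat \<Rightarrow> real set) \<Rightarrow> nat \<Rightarrow> real \<Rightarrow> nat" where
  "distinct_digits p I n x = card ((\<lambda>i. digit p I i x) ` {1..n})"

end

theory Submission
  imports Defs "HOL-Probability.Infinite_Product_Measure" "HOL-Real_Asymp.Real_Asymp"
begin

text \<open>
  A cylinder of level \<open>n\<close>, the set of points whose first \<open>n\<close> digits form a given word \<open>w\<close>, is a
  half-open interval of length \<open>p (w 0) * \<dots> * p (w (n - 1))\<close>. Both bounds for the dimension
  compare the \<open>s\<close>-th powers of these products, and the regular variation of \<open>p\<close> enters only
  through the bounds \<open>c * k powr (- \<rho> - e) \<le> p k \<le> C * k powr (- \<rho> + e)\<close>, valid for every \<open>e > 0\<close>.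

  Upper bound, \<open>s > 1 / \<rho>\<close>. The series \<open>\<Sum> (p k) powr s\<close> converges. If a point has at least
  \<open>\<theta> * n / 2\<close> different digits among the first \<open>n\<close>, then for every fixed \<open>K\<close> all but at most \<open>K\<close> of
  these different digits exceed \<open>K\<close>. Multiply the weight of each digit beyond \<open>K\<close> by a large
  number \<open>M\<close>; when \<open>K\<close> is large the total weight of one digit grows by at most 1, while the
  weight of the words in question grows by about \<open>M powr (\<theta> * n / 2)\<close>. For suitable \<open>M\<close> their
  cylinders of level \<open>n\<close> thus have total \<open>s\<close>-weight \<open>O(2 ^ -n)\<close>, and the cylinders of all levels
  \<open>n \<ge> n0\<close> cover the set at an arbitrarily small cost
  (\<open>hausdorff_pre_many_distinct_digits\<close>).

  Lower bound, \<open>s < 1 / \<rho>\<close>. The corresponding series diverges, so that there are pairwise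
  disjoint blocks \<open>B n\<close> of digits with \<open>card (B n) * (min p) powr s\<close> as large as desired, and with
  minima that decay only polynomially in \<open>n\<close> (\<open>disjoint_digit_blocks\<close>). Let the \<open>n\<close>-th digit
  range over \<open>B n\<close> at a set of times of density \<open>\<theta>\<close>, and be \<open>1\<close> otherwise. The digits at the
  chosen times are all different, hence the number of different digits is \<open>\<theta> * n + O(1)\<close>. The
  blocks can be chosen so rich that they outweigh the factors \<open>(p 1) powr s\<close> of the other times
  by \<open>2 ^ n\<close>: under the product of the uniform distributions a cylinder of level \<open>n\<close> and length
  \<open>l\<close> has mass at most a constant times \<open>2 ^ -n * l powr s\<close>. The exponential gain is what makes
  the estimate independent of the order in which the branch intervals lie in \<open>[0,1)\<close>. A set of
  diameter \<open>r\<close> is covered by the cylinders that are the first in their nested sequence with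
  length at most \<open>r\<close>; they are disjoint and have total length at most \<open>4 * r\<close>, and each is longer
  than \<open>r\<close> times the smallest \<open>p k\<close> of its last digit set, a polynomial factor that the gain
  absorbs. The mass distribution argument (\<open>hausdorff_pre_digit_blocks\<close>) then gives a positive
  Hausdorff content.
\<close>

section \<open>Hausdorff content of countable covers\<close>

text \<open>
  Covers are indexed by the natural numbers, while cylinders are naturally indexed by words. Since
  a countable index set embeds into the natural numbers and the empty set costs nothing, any
  countable index set will do, and its cost needs to be controlled on finite subsets only.
\<close>

lemma hausdorff_pre_le_countable_cover:
  fixes V :: "'j \<Rightarrow> 'a::metric_space set" and f :: "'j \<Rightarrow> real"
  assumes J: "countable J" and cover: "A \<subseteq> (\<Union>j\<in>J. V j)" and \<delta>: "0 \<le> \<delta>"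
    and V: "\<And>j. j \<in> J \<Longrightarrow> bounded (V j) \<and> diameter (V j) \<le> \<delta>"
    and f: "\<And>j. j \<in> J \<Longrightarrow> diam_pow s (V j) \<le> ennreal (f j)"
    and f_nonneg: "\<And>j. j \<in> J \<Longrightarrow> 0 \<le> f j"
    and f_sum: "\<And>F. finite F \<Longrightarrow> F \<subseteq> J \<Longrightarrow> sum f F \<le> B"
  shows "hausdorff_pre s \<delta> A \<le> ennreal B"
proof -
  define U where "U i = (if i \<in> to_nat_on J ` J then V (from_nat_into J i) else {})" for i
  have U_enum: "U (to_nat_on J j) = V j" if "j \<in> J" for j
    using that J by (auto simp: U_def)
  have "A \<subseteq> (\<Union>i. U i)"
  proof
    fix x assume "x \<in> A"
    then obtain j where "j \<in> J" "x \<in> V j" using cover by auto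
    then show "x \<in> (\<Union>i. U i)" using U_enum by (intro UN_I[of "to_nat_on J j"]) auto
  qed
  moreover have "bounded (U i) \<and> diameter (U i) \<le> \<delta>" for i
    using V J \<delta> by (auto simp: U_def)
  ultimately have "U \<in> delta_covers \<delta> A" by (auto simp: delta_covers_def)
  then have "hausdorff_pre s \<delta> A \<le> (\<Sum>i. diam_pow s (U i))"
    unfolding hausdorff_pre_def by (rule INF_lower)
  also have "\<dots> \<le> ennreal B"
  proof (rule suminf_le_const)
    fix n
    define F where "F = {j\<in>J. to_nat_on J j < n}"
    have inj: "inj_on (to_nat_on J) F"
      using inj_on_to_nat_on[OF J] by (rule inj_on_subset) (auto simp: F_def)
    have im: "to_nat_on J ` F \<subseteq> {..<n}" by (auto simp: F_def)
    have fin: "finite F" using finite_imageD[OF finite_subset[OF im] inj] by simp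
    have "(\<Sum>i<n. diam_pow s (U i)) = (\<Sum>i\<in>to_nat_on J ` F. diam_pow s (U i))"
      using im by (intro sum.mono_neutral_right) (auto simp: F_def U_def diam_pow_def)
    also have "\<dots> = (\<Sum>j\<in>F. diam_pow s (V j))"
      using inj by (subst sum.reindex) (auto intro!: sum.cong simp: U_enum F_def)
    also have "\<dots> \<le> (\<Sum>j\<in>F. ennreal (f j))" using f by (intro sum_mono) (auto simp: F_def)
    also have "\<dots> = ennreal (sum f F)" using f_nonneg by (intro sum_ennreal) (auto simp: F_def)
    also have "\<dots> \<le> ennreal B" using f_sum[OF fin] by (intro ennreal_leI) (auto simp: F_def)
    finally show "(\<Sum>i<n. diam_pow s (U i)) \<le> ennreal B" .
  qed simp
  finally show ?thesis .
qed

lemma hausdorff_pre_mono_exponent: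
  assumes "0 < s"
  shows "hausdorff_pre s 1 A \<le> hausdorff_pre 0 1 A"
  unfolding hausdorff_pre_def
proof (intro INF_mono bexI)
  fix U :: "nat \<Rightarrow> 'a set" assume U: "U \<in> delta_covers 1 A"
  have "diam_pow s (U i) \<le> diam_pow 0 (U i)" for i
  proof -
    have "bounded (U i)" and "diameter (U i) \<le> 1" using U by (auto simp: delta_covers_def)
    then have "diameter (U i) powr s \<le> 1"
      using assms diameter_ge_0[of "U i"] by (intro powr_le1) auto
    then show ?thesis using assms by (auto simp: diam_pow_def)
  qed
  then show "(\<Sum>i. diam_pow s (U i)) \<le> (\<Sum>i. diam_pow 0 (U i))" by (intro suminf_le) auto
qed

text \<open>
  The exponent \<open>s = 0\<close>, where the cost of a set jumps to 1, competes in the infimum that defines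
  the dimension. It is reduced to positive exponents by comparing contents at scale 1.
\<close>

lemma hausdorff_dim_eqI:
  assumes d: "0 < d"
    and upper: "\<And>s. d < s \<Longrightarrow> hausdorff_measure s A = 0"
    and lower: "\<And>s. 0 < s \<Longrightarrow> s < d \<Longrightarrow> 0 < hausdorff_pre s 1 A"
  shows "hausdorff_dim A = ennreal d"
proof (rule antisym)
  show "hausdorff_dim A \<le> ennreal d"
  proof (rule ennreal_le_epsilon)
    fix e :: real assume e: "0 < e"
    have "hausdorff_dim A \<le> ennreal (d + e)"
      unfolding hausdorff_dim_def using assms e by (intro INF_lower) auto
    then show "hausdorff_dim A \<le> ennreal d + ennreal e"
      using d e by (simp add: ennreal_plus)
  qed
  have pre_le: "hausdorff_pre s 1 A \<le> hausdorff_measure s A" for s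
    unfolding hausdorff_measure_def by (intro SUP_upper) auto
  have "ennreal d \<le> ennreal s" if "0 \<le> s" "hausdorff_measure s A = 0" for s
  proof (intro ennreal_leI leI notI)
    assume "s < d"
    define t where "t = (if s = 0 then d / 2 else s)"
    have t: "0 < t" "t < d" using that d \<open>s < d\<close> by (auto simp: t_def)
    have "0 < hausdorff_pre t 1 A" by (rule lower[OF t])
    also have "\<dots> \<le> hausdorff_pre s 1 A"
      using t hausdorff_pre_mono_exponent[of t A] by (auto simp: t_def)
    also have "\<dots> \<le> 0" using pre_le[of s] that by simp
    finally show False by simp
  qed
  then show "ennreal d \<le> hausdorff_dim A" unfolding hausdorff_dim_def by (auto intro!: INF_greatest)
qed

section \<open>Slowly varying sequences are negligible against powers\<close>

lemma slowly_varying_inverse: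
  assumes "slowly_varying L" shows "slowly_varying (\<lambda>k. 1 / L k)"
  unfolding slowly_varying_def
proof (intro conjI allI impI)
  fix l :: real assume "0 < l"
  then have "(\<lambda>k. L (nat \<lfloor>l * real k\<rfloor>) / L k) \<longlonglongrightarrow> 1"
    using assms by (auto simp: slowly_varying_def)
  from tendsto_inverse[OF this]
  show "(\<lambda>k. 1 / L (nat \<lfloor>l * real k\<rfloor>) / (1 / L k)) \<longlonglongrightarrow> 1"
    by (simp add: inverse_eq_divide)
qed (use assms in \<open>auto simp: slowly_varying_def\<close>)

text \<open>
  Far out, halving \<open>k\<close> changes \<open>L\<close> by a factor less than
  \<open>2 powr e\<close>, the factor by which it changes \<open>k powr e\<close>, so the bound propagates from \<open>k div 2\<close>
  to \<open>k\<close>.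
\<close>

lemma slowly_varying_le_powr:
  assumes L: "slowly_varying L" and e: "0 < e"
  obtains C where "0 < C" "\<And>k. 1 \<le> k \<Longrightarrow> L k \<le> C * real k powr e"
proof -
  have L_pos: "L k > 0" if "1 \<le> k" for k using L that by (auto simp: slowly_varying_def)
  define g :: real where "g = 2 powr e"
  have g: "1 < g" using e by (simp add: g_def)
  have half: "nat \<lfloor>1 / 2 * real k\<rfloor> = k div 2" for k
    by (metis (no_types) floor_divide_of_nat_eq mult.commute nat_int of_nat_numeral times_divide_eq_right mult_1_right)
  have "(\<lambda>k. L (nat \<lfloor>1 / 2 * real k\<rfloor>) / L k) \<longlonglongrightarrow> 1"
    using L unfolding slowly_varying_def by (metis half_gt_zero zero_less_one)
  then have "(\<lambda>k. L (k div 2) / L k) \<longlonglongrightarrow> 1" unfolding half .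
  moreover have "1 / g < 1" using g by simp
  ultimately have "\<forall>\<^sub>F k in sequentially. 1 / g < L (k div 2) / L k"
    by (rule order_tendstoD)
  then obtain k0 where k0: "\<And>k. k0 \<le> k \<Longrightarrow> 1 / g < L (k div 2) / L k"
    by (auto simp: eventually_sequentially)
  define C where "C = 1 + (\<Sum>k\<in>{1..k0 + 1}. L k)"
  have sum_pos: "0 \<le> (\<Sum>k\<in>{1..k0 + 1}. L k)" using L_pos
    by (intro sum_nonneg) (auto intro: less_imp_le)
  have "L k \<le> C * real k powr e" if "1 \<le> k" for k
    using that
  proof (induction k rule: less_induct)
    case (less k)
    show ?case
    proof (cases "k \<le> k0 + 1")
      case True
      have "L k \<le> (\<Sum>k\<in>{1..k0 + 1}. L k)"
        using True less.prems L_pos by (intro member_le_sum) (auto intro: less_imp_le)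
      also have "\<dots> \<le> C * 1" by (simp add: C_def)
      also have "\<dots> \<le> C * real k powr e"
        using less.prems e sum_pos by (intro mult_left_mono ge_one_powr_ge_zero) (auto simp: C_def)
      finally show ?thesis .
    next
      case False
      then have k: "2 \<le> k" "k0 \<le> k" by auto
      have "L k < g * L (k div 2)"
        using k0[OF k(2)] g L_pos[OF less.prems] by (simp add: field_simps)
      also have "\<dots> \<le> g * (C * real (k div 2) powr e)"
        using less.IH[of "k div 2"] k g by (intro mult_left_mono) auto
      also have "\<dots> \<le> g * (C * (real k / 2) powr e)"
        using g sum_pos e by (intro mult_left_mono powr_mono2) (auto simp: C_def)
      also have "\<dots> = C * real k powr e" by (simp add: g_def powr_divide)
      finally show ?thesis by simp
    qed
  qed
  then show ?thesis using sum_pos by (intro that[of C]) (auto simp: C_def)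
qed

lemma regularly_varying_powr_bounds:
  assumes p: "\<And>k. 1 \<le> k \<Longrightarrow> 0 < p k" and rv: "regularly_varying p \<rho>" and e: "0 < e"
  obtains c C where "0 < c" "0 < C"
    "\<And>k. 1 \<le> k \<Longrightarrow> c * real k powr (- \<rho> - e) \<le> p k"
    "\<And>k. 1 \<le> k \<Longrightarrow> p k \<le> C * real k powr (- \<rho> + e)"
proof -
  obtain L where L: "slowly_varying L"
    and lim: "(\<lambda>k. p k / (real k powr (- \<rho>) * L k)) \<longlonglongrightarrow> 1"
    using rv by (auto simp: regularly_varying_def)
  have L_pos: "L k > 0" if "1 \<le> k" for k using L that by (auto simp: slowly_varying_def)
  obtain C1 where C1: "0 < C1" "\<And>k. 1 \<le> k \<Longrightarrow> L k \<le> C1 * real k powr e"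
    using slowly_varying_le_powr[OF L e] by metis
  obtain C2 where C2: "0 < C2" "\<And>k. 1 \<le> k \<Longrightarrow> 1 / L k \<le> C2 * real k powr e"
    using slowly_varying_le_powr[OF slowly_varying_inverse[OF L] e] by metis
  define q where "q k = p k / (real k powr (- \<rho>) * L k)" for k
  have q_pos: "0 < q k" if "1 \<le> k" for k using that p L_pos by (simp add: q_def)
  have p_eq: "p k = q k * (real k powr (- \<rho>) * L k)" if "1 \<le> k" for k
    using that L_pos[OF that] by (simp add: q_def)
  have lim: "q \<longlonglongrightarrow> 1" using lim by (simp add: q_def[abs_def])
  obtain D1 where D1: "0 < D1" "\<And>k. norm (q k) \<le> D1"
    using convergent_imp_Bseq[OF convergentI[OF lim]] by (auto elim: BseqE)
  have "(\<lambda>k. inverse (q k)) \<longlonglongrightarrow> 1" using tendsto_inverse[OF lim] by simp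
  from convergent_imp_Bseq[OF convergentI[OF this]]
  obtain D2 where D2: "0 < D2" "\<And>k. norm (inverse (q k)) \<le> D2" by (auto elim: BseqE)
  show ?thesis
  proof (rule that[of "1 / (D2 * C2)" "D1 * C1"])
    fix k :: nat assume k: "1 \<le> k"
    note pos = q_pos[OF k] L_pos[OF k]
    have "q k \<le> D1" using D1(2)[of k] pos by simp
    have "p k \<le> D1 * (real k powr (- \<rho>) * (C1 * real k powr e))"
      unfolding p_eq[OF k] using D1 C1 k pos \<open>q k \<le> D1\<close> by (intro mult_mono) auto
    also have "\<dots> = D1 * C1 * real k powr (- \<rho> + e)" by (subst powr_add) simp
    finally show "p k \<le> D1 * C1 * real k powr (- \<rho> + e)" .
    have "1 / D2 \<le> q k" using D2(2)[of k] D2(1) pos by (simp add: field_simps)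
    have "1 / (C2 * real k powr e) \<le> L k" using C2(2)[OF k] C2(1) k pos by (simp add: field_simps)
    have "1 / (D2 * C2) * real k powr (- \<rho> - e)
        = 1 / D2 * (real k powr (- \<rho>) * (1 / (C2 * real k powr e)))"
      using k by (simp add: powr_diff)
    also have "\<dots> \<le> p k"
      unfolding p_eq[OF k] using D2 C2 k pos \<open>1 / D2 \<le> q k\<close> \<open>_ \<le> L k\<close> by (intro mult_mono) auto
    finally show "1 / (D2 * C2) * real k powr (- \<rho> - e) \<le> p k" .
  qed (use C1 C2 D1 D2 in auto)
qed

text \<open>
  Choosing \<open>e\<close> as half of the slack in \<open>s * \<rho> > 1\<close> leaves a convergent majorant
  \<open>\<Sum> k powr (-(s * \<rho> + 1) / 2)\<close>.
\<close>

lemma summable_powr_regularly_varying: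
  assumes p: "\<And>k. 1 \<le> k \<Longrightarrow> 0 < p k" and rv: "regularly_varying p \<rho>" and "0 < \<rho>" and s: "1 / \<rho> < s"
  shows "summable (\<lambda>k. p k powr s)"
proof -
  have "0 < 1 / \<rho>" using \<open>0 < \<rho>\<close> by simp
  then have s0: "0 < s" using s by linarith
  define e where "e = (\<rho> - 1 / s) / 2"
  have "1 < s * \<rho>" using s \<open>0 < \<rho>\<close> by (simp add: field_simps)
  then have e: "0 < e" using s0 by (simp add: e_def field_simps)
  obtain C where C: "0 < C" "\<And>k. 1 \<le> k \<Longrightarrow> p k \<le> C * real k powr (- \<rho> + e)"
    using regularly_varying_powr_bounds[OF p rv e] by metis
  have exponent: "(- \<rho> + e) * s < -1" using \<open>1 < s * \<rho>\<close> s0 by (simp add: e_def field_simps)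
  show ?thesis
  proof (rule summable_comparison_test')
    show "summable (\<lambda>k. C powr s * real k powr ((- \<rho> + e) * s))"
      using exponent by (intro summable_mult) (simp add: summable_real_powr_iff)
    fix k :: nat assume k: "1 \<le> k"
    have "p k powr s \<le> (C * real k powr (- \<rho> + e)) powr s"
      using C(2)[OF k] p[OF k] s0 by (intro powr_mono2) auto
    also have "\<dots> = C powr s * real k powr ((- \<rho> + e) * s)"
      using C(1) by (simp add: powr_mult powr_powr)
    finally show "norm (p k powr s) \<le> C powr s * real k powr ((- \<rho> + e) * s)" by simp
  qed
qed

section \<open>Cylinders of the full-branch map\<close>

locale full_branch =
  fixes p :: "nat \<Rightarrow> real" and I :: "nat \<Rightarrow> real set"
  assumes prob: "probability_sequence p" and part: "interval_partition p I"
begin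

abbreviation "T \<equiv> full_branch_map p I"

text \<open>
  Digits are counted from 0 here, so that the first \<open>n\<close> digits form a function on \<open>{..<n}\<close>.
\<close>

abbreviation "dg i x \<equiv> digit p I (Suc i) x"

lemma p_pos: "1 \<le> k \<Longrightarrow> 0 < p k"
  using prob by (auto simp: probability_sequence_def)

text \<open>
  There are at least two branches, so no branch has full length. This makes the lengths of
  cylinders decay exponentially in the level.
\<close>

lemma p_bounded_away_from_1:
  obtains \<theta> where "0 < \<theta>" "\<theta> < 1" "\<And>k. 1 \<le> k \<Longrightarrow> p k \<le> \<theta>"
proof -
  define \<theta> where "\<theta> = 1 - min (p 1) (p 2)"
  have two: "p i + p j \<le> 1" if "1 \<le> i" "1 \<le> j" "i \<noteq> j" for i j
  proof -
    have "sum p {i, j} \<le> 1"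
      using prob that by (intro finite_sum_le_has_sum[where A = "{1..}"])
        (auto simp: probability_sequence_def intro: less_imp_le)
    then show ?thesis using that by simp
  qed
  have "p k \<le> \<theta>" if "1 \<le> k" for k
    using two[of k 1] two[of k 2] that by (cases "k = 1") (auto simp: \<theta>_def min_def)
  moreover have "0 < \<theta>" using p_pos[of 1] calculation[of 1] by simp
  moreover have "\<theta> < 1" using p_pos[of 1] p_pos[of 2] by (auto simp: \<theta>_def)
  ultimately show ?thesis using that by blast
qed

lemma I_eq:
  assumes "1 \<le> k" shows "I k = {Inf (I k)..<Inf (I k) + p k}"
proof -
  obtain a b where ab: "I k = {a..<b}" and diam: "diameter (I k) = p k"
    using part assms by (auto simp: interval_partition_def)
  have "a < b"
  proof (rule ccontr)
    assume "\<not> a < b"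
    then have "diameter (I k) = 0" by (simp add: ab)
    then show False using p_pos[OF assms] diam by simp
  qed
  then have "diameter {a..<b} = b - a"
    using diameter_closure[of "{a..<b}"] by (simp add: closure_atLeastLessThan)
  then have "b = a + p k" using ab diam by simp
  then show ?thesis using ab \<open>a < b\<close> by simp
qed

lemma I_subset: "1 \<le> k \<Longrightarrow> I k \<subseteq> {0..<1}"
  using part by (auto simp: interval_partition_def)

lemma I_bounds:
  assumes "1 \<le> k" shows "0 \<le> Inf (I k)" "Inf (I k) + p k \<le> 1"
proof -
  have "{Inf (I k)..<Inf (I k) + p k} \<subseteq> {0..<1}" using I_eq[OF assms] I_subset[OF assms] by metis
  then show "0 \<le> Inf (I k)" "Inf (I k) + p k \<le> 1"
    using p_pos[OF assms] by (auto dest!: atLeastLessThan_subset_iff)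
qed

lemma I_disjoint: "1 \<le> k \<Longrightarrow> 1 \<le> j \<Longrightarrow> x \<in> I k \<Longrightarrow> x \<in> I j \<Longrightarrow> j = k"
  using part disjoint_family_onD[of I "{1..}" j k] unfolding interval_partition_def by blast

lemma branch_in:
  assumes "x \<in> {0..<1}" shows "1 \<le> branch I x" "x \<in> I (branch I x)"
proof -
  have "x \<in> (\<Union>k\<in>{1..}. I k)" using part assms unfolding interval_partition_def by metis
  then obtain k where k: "1 \<le> k" "x \<in> I k" by auto
  have "branch I x = k" unfolding branch_def using k I_disjoint by (intro the_equality) auto
  then show "1 \<le> branch I x" "x \<in> I (branch I x)" using k by auto
qed

lemma branch_eq_iff:
  assumes "x \<in> {0..<1}" "1 \<le> k" shows "branch I x = k \<longleftrightarrow> x \<in> I k"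
  using branch_in[OF assms(1)] I_disjoint[OF assms(2)] by metis

lemma T_in:
  assumes "x \<in> {0..<1}" shows "T x \<in> {0..<1}"
proof -
  have "x \<in> {Inf (I (branch I x))..<Inf (I (branch I x)) + p (branch I x)}"
    using branch_in[OF assms] I_eq by metis
  then show ?thesis
    using p_pos[OF branch_in(1)[OF assms]] by (auto simp: full_branch_map_def field_simps)
qed

lemma funpow_T_in: "x \<in> {0..<1} \<Longrightarrow> (T ^^ n) x \<in> {0..<1}"
  by (induction n) (simp_all del: atLeastLessThan_iff add: T_in)

lemma digit_ge_1: "x \<in> {0..<1} \<Longrightarrow> 1 \<le> dg i x"
  by (simp add: digit_def branch_in(1)[OF funpow_T_in] del: One_nat_def)

definition len :: "(nat \<Rightarrow> nat) \<Rightarrow> nat \<Rightarrow> real" where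
  "len w n = (\<Prod>i<n. p (w i))"

primrec left_end :: "(nat \<Rightarrow> nat) \<Rightarrow> nat \<Rightarrow> real" where
  "left_end w 0 = 0"
| "left_end w (Suc n) = left_end w n + len w n * Inf (I (w n))"

text \<open>
  Words are functions of which only the values below the level \<open>n\<close> count.
\<close>

definition cyl :: "(nat \<Rightarrow> nat) \<Rightarrow> nat \<Rightarrow> real set" where
  "cyl w n = {x \<in> {0..<1}. \<forall>i<n. dg i x = w i}"

lemma len_pos: "(\<And>i. i < n \<Longrightarrow> 1 \<le> w i) \<Longrightarrow> 0 < len w n"
  unfolding len_def by (intro prod_pos) (auto intro: p_pos)

lemma len_Suc: "len w (Suc n) = len w n * p (w n)"
  by (simp add: len_def)

lemma len_cong: "(\<And>i. i < n \<Longrightarrow> v i = w i) \<Longrightarrow> len v n = len w n"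
  by (simp add: len_def)

lemma len_le_power:
  assumes "\<And>k. 1 \<le> k \<Longrightarrow> p k \<le> \<theta>" and "\<And>i. i < n \<Longrightarrow> 1 \<le> w i"
  shows "len w n \<le> \<theta> ^ n"
proof -
  have "len w n \<le> (\<Prod>i<n. \<theta>)"
    unfolding len_def using assms by (intro prod_mono) (use p_pos in \<open>auto intro: less_imp_le\<close>)
  then show ?thesis by simp
qed

text \<open>
  Passing to the next level splits a cylinder in the same proportions as \<open>[0,1)\<close> is split by the
  intervals \<open>I k\<close>, because \<open>T ^^ n\<close> maps the cylinder affinely onto \<open>[0,1)\<close>. The two assertions
  are therefore proved together.
\<close>

lemma cyl_interval_affine:
  assumes "\<And>i. i < n \<Longrightarrow> 1 \<le> w i"
  shows "cyl w n = {left_end w n..<left_end w n + len w n} \<and>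
    (\<forall>x\<in>cyl w n. (T ^^ n) x = (x - left_end w n) / len w n)"
  using assms
proof (induction n)
  case 0
  then show ?case by (auto simp: cyl_def len_def)
next
  case (Suc n)
  let ?a = "left_end w n" and ?l = "len w n" and ?b = "Inf (I (w n))"
  have IH: "cyl w n = {?a..<?a + ?l}" "\<And>x. x \<in> cyl w n \<Longrightarrow> (T ^^ n) x = (x - ?a) / ?l"
    using Suc by auto
  have l: "0 < ?l" using Suc.prems by (intro len_pos) auto
  have w: "1 \<le> w n" using Suc.prems by simp
  have pw: "0 < p (w n)" using p_pos[OF w] .
  have step: "x \<in> cyl w (Suc n) \<longleftrightarrow> x \<in> cyl w n \<and> (x - ?a) / ?l \<in> I (w n)" for x
  proof -
    have "x \<in> cyl w (Suc n) \<longleftrightarrow> x \<in> cyl w n \<and> branch I ((T ^^ n) x) = w n"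
      by (auto simp: cyl_def less_Suc_eq digit_def)
    also have "\<dots> \<longleftrightarrow> x \<in> cyl w n \<and> (T ^^ n) x \<in> I (w n)"
      using branch_eq_iff[OF funpow_T_in w, of x n] by (auto simp: cyl_def)
    finally show ?thesis using IH(2) by auto
  qed
  have sub: "0 \<le> ?b" "?b + p (w n) \<le> 1" using I_bounds[OF w] by auto
  have "cyl w (Suc n) = {?a + ?l * ?b..<?a + ?l * ?b + ?l * p (w n)}"
  proof (intro set_eqI)
    fix x
    have "(x - ?a) / ?l \<in> I (w n) \<longleftrightarrow> (x - ?a) / ?l \<in> {?b..<?b + p (w n)}"
      using I_eq[OF w] by simp
    also have "\<dots> \<longleftrightarrow> x \<in> {?a + ?l * ?b..<?a + ?l * ?b + ?l * p (w n)}"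
      using l by (auto simp: field_simps)
    finally have "x \<in> cyl w (Suc n) \<longleftrightarrow>
        x \<in> cyl w n \<and> x \<in> {?a + ?l * ?b..<?a + ?l * ?b + ?l * p (w n)}"
      using step by simp
    moreover have "0 \<le> ?l * ?b" using l sub by simp
    moreover have "?l * ?b + ?l * p (w n) \<le> ?l"
      using mult_left_mono[OF sub(2), of ?l] l by (simp add: distrib_left)
    ultimately show "x \<in> cyl w (Suc n) \<longleftrightarrow> x \<in> {?a + ?l * ?b..<?a + ?l * ?b + ?l * p (w n)}"
      unfolding IH(1) by auto
  qed
  moreover have "(T ^^ Suc n) x = (x - left_end w (Suc n)) / len w (Suc n)"
    if x: "x \<in> cyl w (Suc n)" for x
  proof -
    have "(T ^^ Suc n) x = ((T ^^ n) x - ?b) / p (w n)"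
      using x by (auto simp: cyl_def full_branch_map_def digit_def)
    also have "(T ^^ n) x = (x - ?a) / ?l" using IH(2) step x by auto
    finally show ?thesis using l pw by (simp add: len_Suc field_simps)
  qed
  ultimately show ?case by (simp add: len_Suc)
qed

lemma cyl_eq:
  "(\<And>i. i < n \<Longrightarrow> 1 \<le> w i) \<Longrightarrow> cyl w n = {left_end w n..<left_end w n + len w n}"
  using cyl_interval_affine by blast

text \<open>
  The intersection of nested half-open intervals is empty when their right ends are eventually
  constant. This happens only if from some level on every digit selects the rightmost branch, and
  there is at most one such branch; a digit sequence that is not eventually constant is safe.
\<close>

lemma digits_realized:
  assumes w: "\<And>i. 1 \<le> w i" and not_const: "\<And>n. \<exists>m\<ge>n. w m \<noteq> w n"
  obtains x where "x \<in> {0..<1}" "\<And>i. dg i x = w i"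
proof -
  define R where "R n = left_end w n + len w n" for n
  have l: "0 < len w n" for n using w by (intro len_pos) auto
  have lR: "left_end w n < R n" for n using l by (simp add: R_def)
  have left_mono: "left_end w n \<le> left_end w (Suc n)" for n
    using l[of n] I_bounds(1)[OF w[of n]] by simp
  have R_Suc: "R (Suc n) = left_end w n + len w n * (Inf (I (w n)) + p (w n))" for n
    by (simp add: R_def len_Suc distrib_left)
  have R_anti: "R (Suc n) \<le> R n" for n
    using mult_left_mono[OF I_bounds(2)[OF w[of n]], of "len w n"] l[of n]
    unfolding R_Suc by (simp add: R_def)
  note mono = lift_Suc_mono_le[of "left_end w", OF left_mono]
  note anti = lift_Suc_antimono_le[of R, OF R_anti]
  have cross: "left_end w n \<le> R m" for n m
    using mono[of n "max n m"] anti[of m "max n m"] lR[of "max n m"] by linarith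
  define x where "x = (SUP n. left_end w n)"
  have bdd: "bdd_above (range (left_end w))" using cross by (intro bdd_aboveI[of _ "R 0"]) auto
  have ge: "left_end w n \<le> x" for n unfolding x_def using bdd by (intro cSUP_upper) auto
  have le: "x \<le> R n" for n unfolding x_def using cross by (intro cSUP_least) auto
  have "x < R n" for n
  proof (rule ccontr)
    assume "\<not> x < R n"
    then have x: "x = R n" using le[of n] by simp
    have const: "R m = x" if "n \<le> m" for m using anti[OF that] le[of m] x by simp
    have right: "Inf (I (w m)) + p (w m) = 1" if "n \<le> m" for m
    proof -
      have "R (Suc m) = R m" using const that by simp
      then have "len w m * (Inf (I (w m)) + p (w m)) = len w m * 1"
        unfolding R_Suc by (simp add: R_def)
      then show ?thesis using l[of m] by (metis mult_left_cancel less_irrefl)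
    qed
    obtain m where m: "n \<le> m" "w m \<noteq> w n" using not_const by blast
    define y where "y = max (Inf (I (w m))) (Inf (I (w n)))"
    have "y < 1" using right[OF m(1)] right[of n] p_pos[OF w, of m] p_pos[OF w, of n]
      by (auto simp: y_def)
    then have "y \<in> I (w m)" "y \<in> I (w n)"
      using I_eq[OF w, of m] I_eq[OF w, of n] right[OF m(1)] right[of n] by (auto simp: y_def)
    then show False using I_disjoint[OF w w] m by blast
  qed
  then have "x \<in> cyl w n" for n using ge by (subst cyl_eq) (use w in \<open>auto simp: R_def\<close>)
  then show ?thesis using that[of x] unfolding cyl_def by blast
qed

end

section \<open>Points with many distinct digits\<close>

lemma sum_half_powers_le:
  "(\<Sum>n\<in>{n0..N}. (1 / 2 :: real) ^ n) \<le> 2 * (1 / 2) ^ n0"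
proof -
  have eq: "(\<Sum>n\<in>{n0..<n0 + m}. (1 / 2 :: real) ^ n) = 2 * (1 / 2) ^ n0 - 2 * (1 / 2) ^ (n0 + m)" for m
    by (induction m) auto
  have "(\<Sum>n\<in>{n0..N}. (1 / 2 :: real) ^ n) \<le> (\<Sum>n\<in>{n0..<n0 + Suc N}. (1 / 2) ^ n)"
    by (intro sum_mono2) auto
  then show ?thesis unfolding eq by (smt (verit) zero_le_power divide_nonneg_nonneg)
qed

context full_branch
begin

lemma diameter_cyl_le:
  assumes "\<And>i. i < n \<Longrightarrow> 1 \<le> w i" shows "diameter (cyl w n) \<le> len w n"
  using len_pos[of n w] cyl_eq[of n w] assms by (intro diameter_le) (auto intro: less_imp_le)

lemma distinct_digits_eq: "distinct_digits p I n x = card ((\<lambda>i. dg i x) ` {..<n})"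
proof -
  have "(\<lambda>i. digit p I i x) ` {1..n} = (\<lambda>i. digit p I i x) ` Suc ` {..<n}"
    by (simp only: image_Suc_lessThan)
  then show ?thesis by (simp add: distinct_digits_def image_image)
qed

text \<open>
  At most \<open>K\<close> of the different digits are at most \<open>K\<close>, as digits are positive.
\<close>

lemma distinct_digits_le:
  assumes "x \<in> {0..<1}"
  shows "distinct_digits p I n x \<le> K + card {i. i < n \<and> K < dg i x}"
proof -
  have "(\<lambda>i. dg i x) ` {..<n} \<subseteq> {1..K} \<union> (\<lambda>i. dg i x) ` {i. i < n \<and> K < dg i x}"
    using digit_ge_1[OF assms] by (auto simp: not_less[symmetric] simp del: One_nat_def)
  then have "distinct_digits p I n x \<le> card ({1..K} \<union> (\<lambda>i. dg i x) ` {i. i < n \<and> K < dg i x})"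
    unfolding distinct_digits_eq by (intro card_mono) auto
  also have "\<dots> \<le> card {1..K} + card ((\<lambda>i. dg i x) ` {i. i < n \<and> K < dg i x})" by (rule card_Un_le)
  also have "\<dots> \<le> K + card {i. i < n \<and> K < dg i x}" by (simp add: card_image_le)
  finally show ?thesis .
qed

text \<open>
  Cover by the cylinders of all levels \<open>n \<ge> n0\<close> whose word has at least \<open>\<theta> * n - K\<close> digits beyond
  \<open>K\<close>. The weight \<open>f\<close> equals \<open>(p k) powr s\<close>, multiplied by \<open>M\<close> for digits \<open>k > K\<close>. For a word of
  this kind the product of the weights is at least \<open>M powr (\<theta> * n - K)\<close> times the \<open>s\<close>-th power of
  the length, whereas over all words of length \<open>n\<close> these products sum to at most
  \<open>(\<sigma> + 1) ^ n\<close>, and \<open>M powr \<theta>\<close> is twice \<open>\<sigma> + 1\<close>. It is enough that the inequality for the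
  number of different digits holds for infinitely many \<open>n\<close>.
\<close>

lemma hausdorff_pre_many_distinct_digits:
  assumes s: "0 < s" and sum: "summable (\<lambda>k. p k powr s)" and \<theta>: "0 < \<theta>" and \<delta>: "0 < \<delta>"
    and A: "A \<subseteq> {0..<1}" "\<And>x. x \<in> A \<Longrightarrow> \<exists>\<^sub>F n in sequentially. \<theta> * real n \<le> real (distinct_digits p I n x)"
  shows "hausdorff_pre s \<delta> A = 0"
proof -
  define a where "a k = p k powr s" for k
  have a: "0 \<le> a k" "summable a" for k using sum by (auto simp: a_def[abs_def])
  define \<sigma> where "\<sigma> = suminf a"
  have \<sigma>: "0 \<le> \<sigma>" unfolding \<sigma>_def using a by (intro suminf_nonneg) auto
  define M where "M = (2 * (\<sigma> + 1)) powr (1 / \<theta>)"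
  have M1: "1 \<le> M" unfolding M_def using \<sigma> \<theta> by (intro ge_one_powr_ge_zero) auto
  have M\<theta>: "M powr \<theta> = 2 * (\<sigma> + 1)" using \<sigma> \<theta> by (simp add: M_def powr_powr)
  obtain K where K: "\<And>n. K \<le> n \<Longrightarrow> norm (\<Sum>i. a (i + n)) < 1 / M"
    using suminf_exist_split[of "1 / M" a] a M1 by auto
  have tail: "M * (\<Sum>k\<in>{K<..R}. a k) \<le> 1" for R
  proof -
    have "sum a ({..K} \<union> {K<..R}) \<le> suminf a" using a by (intro sum_le_suminf) auto
    then have "sum a {..K} + sum a {K<..R} \<le> suminf a" by (subst (asm) sum.union_disjoint) auto
    moreover have "suminf a = (\<Sum>i. a (i + Suc K)) + sum a {..<Suc K}"
      using a by (intro suminf_split_initial_segment)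
    moreover have "(\<Sum>i. a (i + Suc K)) < 1 / M" using K[of "Suc K"] by simp
    ultimately have "sum a {K<..R} \<le> 1 / M" by (simp add: lessThan_Suc_atMost)
    then show ?thesis using M1 by (simp add: field_simps)
  qed
  define f where "f k = a k * (if K < k then M else 1)" for k
  have f: "0 \<le> f k" for k using a M1 by (simp add: f_def)
  have f_sum: "sum f {1..R} \<le> \<sigma> + 1" for R
  proof -
    have "sum f {1..R} \<le> (\<Sum>k\<in>{1..R}. a k + (if K < k then M * a k else 0))"
      using a M1 by (intro sum_mono) (auto simp: f_def)
    also have "\<dots> = sum a {1..R} + (\<Sum>k\<in>{k\<in>{1..R}. K < k}. M * a k)"
      by (subst sum.inter_filter) (simp_all add: sum.distrib)
    also have "{k\<in>{1..R}. K < k} = {K<..R}" by auto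
    also have "(\<Sum>k\<in>{K<..R}. M * a k) \<le> 1" using tail by (simp add: sum_distrib_left)
    also have "sum a {1..R} \<le> \<sigma>" unfolding \<sigma>_def using a by (intro sum_le_suminf) auto
    finally show ?thesis by simp
  qed
  define J where "J n0 = {(n, w). n0 \<le> n \<and> w \<in> PiE {..<n} (\<lambda>_. {1..}) \<and>
      \<theta> * real n - real K \<le> real (card {i. i < n \<and> K < w i})}" for n0 :: nat
  have J_word: "1 \<le> w i" if "(n, w) \<in> J n0" "i < n" for n0 n w i
    using that by (auto simp: J_def PiE_iff)
  have len_powr_le: "len w n powr s \<le> M powr (real K - \<theta> * real n) * (\<Prod>i<n. f (w i))"
    if nw: "(n, w) \<in> J n0" for n0 n w
  proof -
    let ?m = "card {i. i < n \<and> K < w i}"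
    have "(\<Prod>i<n. f (w i)) = (\<Prod>i<n. a (w i)) * (\<Prod>i<n. if K < w i then M else 1)"
      by (simp add: f_def prod.distrib)
    also have "(\<Prod>i<n. if K < w i then M else 1) = (\<Prod>i\<in>{i\<in>{..<n}. K < w i}. M)"
      by (subst prod.inter_filter) auto
    also have "{i\<in>{..<n}. K < w i} = {i. i < n \<and> K < w i}" by auto
    also have "(\<Prod>i<n. a (w i)) = len w n powr s" by (simp add: a_def len_def prod_powr_distrib)
    finally have prod: "(\<Prod>i<n. f (w i)) = len w n powr s * M powr real ?m"
      using M1 by (simp add: powr_realpow)
    have "M powr (real K - \<theta> * real n) * M powr real ?m = M powr (real K - \<theta> * real n + real ?m)"
      by (simp add: powr_add)
    moreover have "1 \<le> M powr (real K - \<theta> * real n + real ?m)"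
      using nw M1 by (intro ge_one_powr_ge_zero) (auto simp: J_def)
    ultimately have "len w n powr s * 1 \<le> len w n powr s * (M powr (real K - \<theta> * real n) * M powr real ?m)"
      by (intro mult_left_mono) auto
    then show ?thesis by (simp add: prod mult_ac)
  qed
  have sum_bound: "(\<Sum>(n, w)\<in>F. len w n powr s) \<le> M powr K * 2 * (1 / 2) ^ n0"
    if F: "finite F" "F \<subseteq> J n0" for F n0
  proof -
    \<comment> \<open>A finite family of words lives in a finite box of levels and digits, where the sum of
      products factorizes.\<close>
    have "finite (fst ` F \<union> (\<Union>(n, w)\<in>F. w ` {..<n}))" using F(1) by auto
    then obtain R where R: "\<And>k. k \<in> fst ` F \<union> (\<Union>(n, w)\<in>F. w ` {..<n}) \<Longrightarrow> k \<le> R"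
      unfolding finite_nat_set_iff_bounded_le by blast
    define W where "W n = PiE {..<n} (\<lambda>_. {1..R})" for n :: nat
    have FW: "F \<subseteq> (SIGMA n:{n0..R}. W n)"
    proof (rule subrelI)
      fix n w assume nw: "(n, w) \<in> F"
      then have nwJ: "(n, w) \<in> J n0" using F(2) by auto
      have "n \<le> R" using R nw by force
      moreover have "w i \<le> R" if "i < n" for i using R[of "w i"] nw that by auto
      ultimately show "(n, w) \<in> (SIGMA n:{n0..R}. W n)"
        using nwJ J_word[OF nwJ] by (auto simp: J_def W_def PiE_iff)
    qed
    have "(\<Sum>(n, w)\<in>F. len w n powr s) \<le> (\<Sum>(n, w)\<in>F. M powr (real K - \<theta> * real n) * (\<Prod>i<n. f (w i)))"
      using len_powr_le F(2) by (intro sum_mono) auto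
    also have "\<dots> \<le> (\<Sum>(n, w)\<in>(SIGMA n:{n0..R}. W n). M powr (real K - \<theta> * real n) * (\<Prod>i<n. f (w i)))"
      using FW f
        by (intro sum_mono2) (auto simp: W_def intro!: finite_PiE mult_nonneg_nonneg prod_nonneg)
    also have "\<dots> = (\<Sum>n\<in>{n0..R}. \<Sum>w\<in>W n. M powr (real K - \<theta> * real n) * (\<Prod>i<n. f (w i)))"
      by (intro sum.Sigma[symmetric]) (auto simp: W_def intro!: finite_PiE)
    also have "\<dots> = (\<Sum>n\<in>{n0..R}. M powr (real K - \<theta> * real n) * sum f {1..R} ^ n)"
    proof (intro sum.cong refl)
      fix n
      have "(\<Sum>w\<in>W n. \<Prod>i<n. f (w i)) = (\<Prod>i<n. sum f {1..R})"
        unfolding W_def by (rule prod_sum_PiE[symmetric]) auto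
      then show "(\<Sum>w\<in>W n. M powr (real K - \<theta> * real n) * (\<Prod>i<n. f (w i)))
          = M powr (real K - \<theta> * real n) * sum f {1..R} ^ n"
        by (simp add: sum_distrib_left[symmetric])
    qed
    also have "\<dots> \<le> (\<Sum>n\<in>{n0..R}. M powr K * (1 / 2) ^ n)"
    proof (intro sum_mono)
      fix n
      have "M powr (real K - \<theta> * real n) = M powr K / (M powr \<theta>) ^ n"
        using M1 by (simp add: powr_diff powr_powr[symmetric] powr_realpow)
      then have "M powr (real K - \<theta> * real n) * sum f {1..R} ^ n
          \<le> M powr K / (2 * (\<sigma> + 1)) ^ n * (\<sigma> + 1) ^ n"
        using f_sum[of R] f \<sigma> unfolding M\<theta>
          by (intro mult_mono power_mono) (auto intro!: sum_nonneg zero_le_power)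
      also have "\<dots> = M powr K * ((\<sigma> + 1) / (2 * (\<sigma> + 1))) ^ n"
        by (simp only: power_divide times_divide_eq_left times_divide_eq_right)
      also have "(\<sigma> + 1) / (2 * (\<sigma> + 1)) = 1 / 2" using \<sigma> by (simp add: field_simps)
      finally show "M powr (real K - \<theta> * real n) * sum f {1..R} ^ n \<le> M powr K * (1 / 2) ^ n" .
    qed
    also have "\<dots> = M powr K * (\<Sum>n\<in>{n0..R}. (1 / 2) ^ n)" by (simp add: sum_distrib_left)
    also have "\<dots> \<le> M powr K * (2 * (1 / 2) ^ n0)" by (intro mult_left_mono sum_half_powers_le) simp
    finally show ?thesis by simp
  qed
  obtain \<eta> where \<eta>: "0 < \<eta>" "\<eta> < 1" "\<And>k. 1 \<le> k \<Longrightarrow> p k \<le> \<eta>"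
    by (rule p_bounded_away_from_1) blast
  have pre_le: "hausdorff_pre s \<delta> A \<le> ennreal (M powr K * 2 * (1 / 2) ^ n0)" if n0: "\<eta> ^ n0 \<le> \<delta>" for n0
  proof (rule hausdorff_pre_le_countable_cover[where J = "J n0" and V = "\<lambda>(n, w). cyl w n"
        and f = "\<lambda>(n, w). len w n powr s"])
    have "J n0 \<subseteq> (SIGMA n:UNIV. PiE {..<n} (\<lambda>_. {1..}))" by (auto simp: J_def)
    moreover have "countable (SIGMA n:UNIV :: nat set. PiE {..<n} (\<lambda>_. {1..} :: nat set))"
      by (intro countable_SIGMA countable_PiE) auto
    ultimately show "countable (J n0)" by (rule countable_subset)
    show "A \<subseteq> (\<Union>j\<in>J n0. case j of (n, w) \<Rightarrow> cyl w n)"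
    proof
      fix x assume x: "x \<in> A"
      then have x01: "x \<in> {0..<1}" using A by auto
      obtain n where n: "n0 \<le> n" "\<theta> * real n \<le> real (distinct_digits p I n x)"
        using A(2)[OF x] unfolding frequently_sequentially by blast
      define w where "w = restrict (\<lambda>i. dg i x) {..<n}"
      have w: "w i = dg i x" if "i < n" for i using that by (simp add: w_def)
      have "{i. i < n \<and> K < w i} = {i. i < n \<and> K < dg i x}" using w by auto
      then have "\<theta> * real n - real K \<le> real (card {i. i < n \<and> K < w i})"
        using n(2) distinct_digits_le[OF x01, of n K] by simp
      moreover have "w \<in> PiE {..<n} (\<lambda>_. {1..})"
        using digit_ge_1[OF x01] by (auto simp: w_def)
      ultimately have "(n, w) \<in> J n0" using n(1) by (auto simp: J_def)
      moreover have "x \<in> cyl w n" using x01 w by (simp add: cyl_def)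
      ultimately show "x \<in> (\<Union>j\<in>J n0. case j of (n, w) \<Rightarrow> cyl w n)" by blast
    qed
    fix j assume "j \<in> J n0"
    then obtain n w where j: "j = (n, w)" "(n, w) \<in> J n0" by (cases j) auto
    note w1 = J_word[OF j(2)]
    have "len w n \<le> \<eta> ^ n" using \<eta> w1 by (intro len_le_power) auto
    also have "\<dots> \<le> \<eta> ^ n0" using \<eta> j by (intro power_decreasing) (auto simp: J_def)
    finally have "len w n \<le> \<delta>" using n0 by simp
    moreover have bdd: "bounded (cyl w n)" using cyl_eq[of n w] w1 by simp
    ultimately show "bounded (case j of (n, w) \<Rightarrow> cyl w n) \<and> diameter (case j of (n, w) \<Rightarrow> cyl w n) \<le> \<delta>"
      using diameter_cyl_le[of n w] w1 by (auto simp: j simp del: One_nat_def)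
    show "diam_pow s (case j of (n, w) \<Rightarrow> cyl w n) \<le> ennreal (case j of (n, w) \<Rightarrow> len w n powr s)"
      using s diameter_cyl_le[of n w] diameter_ge_0[OF bdd] w1
      by (auto simp: j diam_pow_def intro!: ennreal_leI powr_mono2)
  qed (use \<delta> sum_bound in auto)
  show ?thesis
  proof (rule antisym)
    show "hausdorff_pre s \<delta> A \<le> 0"
    proof (rule ennreal_le_epsilon)
      fix e :: real assume e: "0 < e"
      have pos: "0 < e / (M powr K * 2)" using e M1 by simp
      obtain n1 where n1: "(1 / 2) ^ n1 < e / (M powr K * 2)"
        using real_arch_pow_inv[OF pos, of "1 / 2"] by auto
      obtain n2 where n2: "\<eta> ^ n2 < \<delta>" using real_arch_pow_inv[OF \<delta> \<eta>(2)] by auto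
      have "\<eta> ^ max n1 n2 \<le> \<eta> ^ n2" using \<eta> by (intro power_decreasing) auto
      then have "hausdorff_pre s \<delta> A \<le> ennreal (M powr K * 2 * (1 / 2) ^ max n1 n2)"
        using n2 by (intro pre_le) simp
      also have "\<dots> \<le> ennreal (M powr K * 2 * (1 / 2) ^ n1)"
        by (intro ennreal_leI mult_left_mono power_decreasing) auto
      also have "\<dots> \<le> ennreal e" using n1 M1 by (intro ennreal_leI) (simp add: field_simps)
      finally show "hausdorff_pre s \<delta> A \<le> 0 + ennreal e" by simp
    qed
  qed simp
qed

end

section \<open>Mass distribution on sequences with prescribed digit sets\<close>

context full_branch
begin

text \<open>
  All these cylinders lie within distance \<open>2 * r\<close> of any point of \<open>U\<close>, so their total length is
  bounded by that of an interval of length \<open>4 * r\<close>.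
\<close>

lemma sum_len_disjoint_cylinders_le:
  assumes fin: "finite S"
    and words: "\<And>n w. (n, w) \<in> S \<Longrightarrow> \<forall>i<n. 1 \<le> w i"
    and short: "\<And>n w. (n, w) \<in> S \<Longrightarrow> len w n \<le> r"
    and meets: "\<And>n w. (n, w) \<in> S \<Longrightarrow> cyl w n \<inter> U \<noteq> {}"
    and disj: "pairwise (\<lambda>u v. disjnt (cyl (snd u) (fst u)) (cyl (snd v) (fst v))) S"
    and U: "\<And>x y. x \<in> U \<Longrightarrow> y \<in> U \<Longrightarrow> dist x y \<le> r" and r: "0 < r"
  shows "(\<Sum>(n, w)\<in>S. len w n) \<le> 4 * r"
proof (cases "S = {}")
  case False
  then obtain n0 w0 where "(n0, w0) \<in> S" by auto
  then obtain u where u: "u \<in> U" using meets by fastforce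
  let ?cyl = "\<lambda>v. cyl (snd v) (fst v)"
  have int: "cyl w n = {left_end w n..<left_end w n + len w n}" "0 < len w n"
    if "(n, w) \<in> S" for n w
    using words[OF that] by (auto intro!: cyl_eq len_pos)
  have near: "?cyl v \<subseteq> {u - 2 * r..u + 2 * r}" if v: "v \<in> S" for v
  proof
    fix x assume x: "x \<in> ?cyl v"
    obtain n w where nw: "v = (n, w)" by (cases v)
    note vS = v[unfolded nw]
    obtain y where y: "y \<in> cyl w n" "y \<in> U" using meets[OF vS] by auto
    have "\<bar>x - y\<bar> \<le> len w n" using x y int[OF vS] by (auto simp: nw)
    moreover have "\<bar>y - u\<bar> \<le> r" using U[OF y(2) u] by (simp add: dist_real_def)
    ultimately show "x \<in> {u - 2 * r..u + 2 * r}" using short[OF vS] by auto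
  qed
  have meas: "?cyl v \<in> fmeasurable lborel" if "v \<in> S" for v
    using int[of "fst v" "snd v"] that by (simp add: fmeasurable_def)
  have "(\<Sum>(n, w)\<in>S. len w n) = (\<Sum>v\<in>S. measure lborel (?cyl v))"
    using int(1) int(2)[THEN less_imp_le] by (intro sum.cong) (auto split: prod.splits)
  also have "\<dots> = measure lborel (\<Union>v\<in>S. ?cyl v)"
    using fin meas disj by (intro measure_UNION'[symmetric]) auto
  also have "\<dots> \<le> measure lborel {u - 2 * r..u + 2 * r}"
    using near fin meas fmeasurable_cbox[of "u - 2 * r" "u + 2 * r"]
    by (intro measure_mono_fmeasurable) (auto intro!: sets.finite_UN simp: fmeasurable_def)
  also have "\<dots> = 4 * r" using r by simp
  finally show ?thesis .
qed (use r in simp)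

text \<open>
  The words of \<open>S\<close> are stopped at the first level where the cylinder has length at most \<open>r\<close>, and
  only those whose cylinder meets \<open>U\<close> are kept. A stopped cylinder of level \<open>m + 1\<close> is longer than
  \<open>r * \<beta> m\<close>, since its parent is longer than \<open>r\<close>. Its mass under the product of the uniform
  distributions is therefore at most its length times
  \<open>r powr (s - 1) * \<beta> m powr (s - 1) / (\<Prod>i\<le>m. card (C i) * \<beta> i powr s)\<close>, where the hypothesis on
  \<open>\<beta> n powr (s - 1)\<close> bounds the last quotient by \<open>K\<close>. Summing the lengths gives the factor
  \<open>4 * r\<close>.
\<close>

lemma stopped_words_cover:
  fixes C :: "nat \<Rightarrow> nat set" and \<beta> :: "nat \<Rightarrow> real"
  assumes C: "\<And>i. finite (C i)" "\<And>i. C i \<noteq> {}" "\<And>i. C i \<subseteq> {1..}"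
    and \<beta>: "\<And>i. 0 < \<beta> i" "\<And>i k. k \<in> C i \<Longrightarrow> \<beta> i \<le> p k"
    and s: "0 < s" "s < 1" and K: "1 \<le> K"
    and gain: "\<And>n. \<beta> n powr (s - 1) \<le> K * (\<Prod>i\<le>n. real (card (C i)) * \<beta> i powr s)"
    and r: "0 < r" and U: "\<And>x y. x \<in> U \<Longrightarrow> y \<in> U \<Longrightarrow> dist x y \<le> r"
  shows "\<exists>S. finite S \<and> (\<forall>(n, w)\<in>S. \<forall>i<n. w i \<in> C i) \<and>
    (\<Sum>(n, w)\<in>S. \<Prod>i<n. 1 / real (card (C i))) \<le> 4 * K * r powr s \<and>
    (\<forall>c x. (\<forall>i. c i \<in> C i) \<longrightarrow> x \<in> U \<longrightarrow> x \<in> {0..<1} \<longrightarrow> (\<forall>i. dg i x = c i) \<longrightarrow>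
       (\<exists>(n, w)\<in>S. \<forall>i<n. c i = w i))"
proof (cases "r < 1")
  case False
  \<comment> \<open>The empty word covers everything, at mass 1.\<close>
  have "1 * 1 \<le> 4 * K * r powr s" using False K s by (intro mult_mono ge_one_powr_ge_zero) auto
  then show ?thesis by (intro exI[of _ "{(0, \<lambda>_. 0)}"]) auto
next
  case r1: True
  define S where "S = {(n, w). w \<in> PiE {..<n} C \<and> len w n \<le> r \<and> (\<forall>m<n. r < len w m) \<and> cyl w n \<inter> U \<noteq> {}}"
  have S_word: "w i \<in> C i" "1 \<le> w i" if "(n, w) \<in> S" "i < n" for n w i
    using that C(3)[of i] by (auto simp: S_def PiE_iff)
  obtain \<theta> where \<theta>: "0 < \<theta>" "\<theta> < 1" "\<And>k. 1 \<le> k \<Longrightarrow> p k \<le> \<theta>"    by (rule p_bounded_away_from_1) blast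
  obtain N where N: "\<theta> ^ N < r" using real_arch_pow_inv[OF r \<theta>(2)] by auto
  have short: "len c N < r" if "\<And>i. i < N \<Longrightarrow> 1 \<le> c i" for c
    using len_le_power[of \<theta> N c] \<theta>(3) that N by fastforce
  have "S \<subseteq> (SIGMA n:{..N}. PiE {..<n} C)"
  proof (rule subrelI)
    fix n w assume nw: "(n, w) \<in> S"
    have "n \<le> N"
    proof (rule ccontr)
      assume "\<not> n \<le> N"
      then have "r < len w N" and "\<And>i. i < N \<Longrightarrow> 1 \<le> w i" using nw S_word(2)[OF nw]
        by (auto simp: S_def)
      then show False using short[of w] by fastforce
    qed
    then show "(n, w) \<in> (SIGMA n:{..N}. PiE {..<n} C)" using nw by (auto simp: S_def)
  qed
  moreover have "finite (SIGMA n:{..N}. PiE {..<n} C)" using C(1) by (auto intro!: finite_PiE)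
  ultimately have fin: "finite S" by (rule finite_subset)
  have weight: "(\<Prod>i<n. 1 / real (card (C i))) \<le> K * r powr (s - 1) * len w n" if nw: "(n, w) \<in> S" for n w
  proof -
    have "n \<noteq> 0" using nw r1 by (auto simp: S_def len_def)
    then obtain m where m: "n = Suc m" by (cases n) auto
    have l: "0 < len w n" using S_word(2)[OF nw] by (intro len_pos) auto
    define G where "G = (\<Prod>i<n. real (card (C i)) * \<beta> i powr s)"
    have card: "0 < real (card (C i))" for i using C(1,2)[of i] by (simp add: card_gt_0_iff)
    have \<beta>0: "\<beta> i \<noteq> 0" for i using \<beta>(1)[of i] by simp
    have G: "0 < G" unfolding G_def using card \<beta>0 by (intro prod_pos) auto
    have "r * \<beta> m \<le> len w m * p (w m)"
      using nw S_word[OF nw, of m] m \<beta> r by (intro mult_mono) (auto simp: S_def intro: less_imp_le)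
    then have long: "r * \<beta> m \<le> len w n" by (simp add: m len_Suc)
    have "(\<Prod>i<n. 1 / real (card (C i))) = (\<Prod>i<n. \<beta> i powr s) / G"
      unfolding G_def prod_dividef[symmetric] using card \<beta>0 by (intro prod.cong) auto
    also have "\<dots> \<le> (\<Prod>i<n. p (w i) powr s) / G"
      using G S_word[OF nw] \<beta> s
        by (intro divide_right_mono prod_mono) (auto intro!: powr_mono2 intro: less_imp_le)
    also have "(\<Prod>i<n. p (w i) powr s) = len w n powr s"
      by (simp add: len_def prod_powr_distrib)
    also have "len w n powr s = len w n * len w n powr (s - 1)" using l by (simp add: powr_diff)
    also have "\<dots> / G \<le> len w n * (r * \<beta> m) powr (s - 1) / G"
      using l G r \<beta>(1)[of m] s long by (intro divide_right_mono mult_left_mono powr_mono2') auto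
    also have "\<dots> = len w n * r powr (s - 1) * (\<beta> m powr (s - 1) / G)"
      using r \<beta>(1)[of m] by (simp add: powr_mult)
    also have "\<dots> \<le> len w n * r powr (s - 1) * K"
      using gain[of m] G l
        by (intro mult_left_mono) (auto simp: G_def m lessThan_Suc_atMost divide_simps mult.commute)
    finally show ?thesis by (simp add: mult_ac)
  qed
  have disj: "pairwise (\<lambda>u v. disjnt (cyl (snd u) (fst u)) (cyl (snd v) (fst v))) S"
  proof (intro pairwiseI)
    fix u v assume uv: "u \<in> S" "v \<in> S" "u \<noteq> v"
    obtain n w where u: "u = (n, w)" by (cases u)
    obtain n' w' where v: "v = (n', w')" by (cases v)
    have "False" if "x \<in> cyl w n" "x \<in> cyl w' n'" for x
    proof -
      \<comment> \<open>If one of two stopped words extended the other, it would have been stopped earlier.\<close>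
      have agree: "w i = w' i" if "i < n" "i < n'" for i
        using that \<open>x \<in> cyl w n\<close> \<open>x \<in> cyl w' n'\<close> by (auto simp: cyl_def)
      have "\<not> n < n'" using uv agree len_cong[of n w w'] by (fastforce simp: S_def u v)
      moreover have "\<not> n' < n" using uv agree len_cong[of n' w w'] by (fastforce simp: S_def u v)
      ultimately have "n = n'" by simp
      then have "w = w'" using uv agree unfolding S_def u v by (auto intro: PiE_ext)
      then show False using uv \<open>n = n'\<close> u v by simp
    qed
    then show "disjnt (cyl (snd u) (fst u)) (cyl (snd v) (fst v))" by (auto simp: disjnt_def u v)
  qed
  have total: "(\<Sum>(n, w)\<in>S. len w n) \<le> 4 * r"
    by (rule sum_len_disjoint_cylinders_le[OF fin _ _ _ disj U r]) (use S_word in \<open>auto simp: S_def\<close>)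
  have "(\<Sum>(n, w)\<in>S. \<Prod>i<n. 1 / real (card (C i))) \<le> (\<Sum>(n, w)\<in>S. K * r powr (s - 1) * len w n)"
    using weight by (intro sum_mono) auto
  also have "\<dots> = K * r powr (s - 1) * (\<Sum>(n, w)\<in>S. len w n)"
    by (simp add: sum_distrib_left case_prod_unfold)
  also have "\<dots> \<le> K * r powr (s - 1) * (4 * r)" using K total by (intro mult_left_mono) auto
  also have "\<dots> = 4 * K * r powr s" using r by (simp add: powr_diff)
  finally have sum: "(\<Sum>(n, w)\<in>S. \<Prod>i<n. 1 / real (card (C i))) \<le> 4 * K * r powr s" .
  have cover: "\<exists>(n, w)\<in>S. \<forall>i<n. c i = w i"
    if c: "\<forall>i. c i \<in> C i" and x: "x \<in> U" "x \<in> {0..<1}" "\<forall>i. dg i x = c i" for c x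
  proof -
    have c1: "1 \<le> c i" for i using c C(3)[of i] by (auto simp: subset_eq)
    define n where "n = (LEAST n. len c n \<le> r)"
    have "len c N \<le> r" using short[of c] c1 by fastforce
    then have n: "len c n \<le> r" "\<And>m. m < n \<Longrightarrow> r < len c m"
      unfolding n_def by (rule LeastI, meson not_le not_less_Least)
    define w where "w = restrict c {..<n}"
    have w: "w i = c i" if "i < n" for i using that by (simp add: w_def)
    have "len w m = len c m" if "m \<le> n" for m using that w by (intro len_cong) auto
    moreover have "x \<in> cyl w n" using x w by (simp add: cyl_def)
    moreover have "w \<in> PiE {..<n} C" using c by (auto simp: w_def)
    ultimately have "(n, w) \<in> S" using n x by (auto simp: S_def)
    then show ?thesis using w by (intro bexI[of _ "(n, w)"]) auto
  qed
  show ?thesis using fin S_word(1) sum cover by (intro exI[of _ S]) auto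
qed

text \<open>
  The mass distribution principle, with the mass living on digit sequences rather than on
  \<open>[0,1)\<close>. The sequences whose point lies in a set \<open>U i\<close> of the cover are contained in a finite
  union of cylinder sets of mass at most \<open>4 * K * r i powr s\<close>, which avoids any question about the
  measurability of \<open>U i\<close> or of the coding map. As these unions exhaust the space of sequences, the
  masses sum to at least 1.
\<close>

lemma hausdorff_pre_digit_blocks:
  fixes C :: "nat \<Rightarrow> nat set" and \<beta> :: "nat \<Rightarrow> real"
  assumes C: "\<And>i. finite (C i)" "\<And>i. C i \<noteq> {}" "\<And>i. C i \<subseteq> {1..}"
    and \<beta>: "\<And>i. 0 < \<beta> i" "\<And>i k. k \<in> C i \<Longrightarrow> \<beta> i \<le> p k"
    and s: "0 < s" "s < 1" and K: "1 \<le> K"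
    and gain: "\<And>n. \<beta> n powr (s - 1) \<le> K * (\<Prod>i\<le>n. real (card (C i)) * \<beta> i powr s)"
    and A: "\<And>c. (\<And>i. c i \<in> C i) \<Longrightarrow> \<exists>x\<in>A. x \<in> {0..<1} \<and> (\<forall>i. dg i x = c i)"
  shows "ennreal (1 / (8 * K)) \<le> hausdorff_pre s \<delta> A"
  unfolding hausdorff_pre_def
proof (rule INF_greatest)
  fix U :: "nat \<Rightarrow> real set" assume "U \<in> delta_covers \<delta> A"
  then have cov: "A \<subseteq> (\<Union>i. U i)" and bdd: "\<And>i. bounded (U i)" by (auto simp: delta_covers_def)
  define d where "d i = diameter (U i)" for i
  have d0: "0 \<le> d i" for i using bdd by (simp add: d_def diameter_ge_0)
  have dp: "diam_pow s (U i) = ennreal (d i powr s)" for i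
    using s by (auto simp: diam_pow_def d_def)
  define e where "e = 1 / (8 * K)"
  have e: "0 < e" using K by (simp add: e_def)
  \<comment> \<open>A set of diameter 0 costs nothing, but stopping needs a positive length. The radii are
    enlarged so that the sum of their \<open>s\<close>-th powers grows by just \<open>e\<close>.\<close>
  define r where "r i = (d i powr s + e * (1 / 2) ^ Suc i) powr (1 / s)" for i
  have rs: "r i powr s = d i powr s + e * (1 / 2) ^ Suc i" for i
    using s e by (simp add: r_def powr_powr add_nonneg_nonneg)
  have r0: "0 < r i" for i using e by (simp add: r_def add_nonneg_pos less_imp_neq[THEN not_sym])
  have dr: "d i \<le> r i" for i
  proof -
    have "d i powr s \<le> r i powr s" unfolding rs using e by simp
    then show ?thesis using d0 r0[of i] s by (metis less_imp_le not_le powr_less_mono2)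
  qed
  have "\<forall>i. \<exists>S. finite S \<and> (\<forall>(n, w)\<in>S. \<forall>i<n. w i \<in> C i) \<and>
    (\<Sum>(n, w)\<in>S. \<Prod>i<n. 1 / real (card (C i))) \<le> 4 * K * r i powr s \<and>
    (\<forall>c x. (\<forall>i. c i \<in> C i) \<longrightarrow> x \<in> U i \<longrightarrow> x \<in> {0..<1} \<longrightarrow> (\<forall>i. dg i x = c i) \<longrightarrow>
       (\<exists>(n, w)\<in>S. \<forall>i<n. c i = w i))" (is "\<forall>i. \<exists>S. ?cover i S")
  proof
    fix i
    have "dist x y \<le> r i" if "x \<in> U i" "y \<in> U i" for x y
      using diameter_bounded_bound[OF bdd that] dr[of i] by (simp add: d_def)
    from stopped_words_cover[OF C \<beta> s K gain r0 this] show "\<exists>S. ?cover i S" .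
  qed
  from choice[OF this] obtain S where "\<forall>i. ?cover i (S i)" by (rule exE)
  then have S: "\<And>i. finite (S i)" "\<And>i. \<forall>(n, w)\<in>S i. \<forall>j<n. w j \<in> C j"
    "\<And>i. (\<Sum>(n, w)\<in>S i. \<Prod>i<n. 1 / real (card (C i))) \<le> 4 * K * r i powr s"
    "\<And>i. \<forall>c x. (\<forall>i. c i \<in> C i) \<longrightarrow> x \<in> U i \<longrightarrow> x \<in> {0..<1} \<longrightarrow> (\<forall>i. dg i x = c i) \<longrightarrow>
       (\<exists>(n, w)\<in>S i. \<forall>i<n. c i = w i)"
    by simp_all

  let ?M = "\<lambda>i. uniform_count_measure (C i)"
  interpret product_prob_space ?M UNIV
    using C by (intro product_prob_spaceI prob_space_uniform_count_measure)
  let ?P = "PiM UNIV ?M"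
  have space: "space ?P = {c. \<forall>i. c i \<in> C i}"
    by (auto simp: space_PiM space_uniform_count_measure PiE_iff)
  define cylinder where "cylinder v = {c \<in> space ?P. \<forall>i\<in>{..<fst v}. c i \<in> {snd v i}}" for v :: "nat \<times> (nat \<Rightarrow> nat)"
  have cylinder: "emeasure ?P (cylinder v) = ennreal (\<Prod>i<fst v. 1 / real (card (C i)))" "cylinder v \<in> sets ?P"
    if "v \<in> S j" for v j
  proof -
    have X: "{snd v i} \<in> sets (?M i)" if "i \<in> {..<fst v}" for i
      using S(2)[of j] that \<open>v \<in> S j\<close> by (auto simp: sets_uniform_count_measure)
    have "emeasure ?P (cylinder v) = (\<Prod>i<fst v. emeasure (?M i) {snd v i})"
      unfolding cylinder_def by (rule emeasure_PiM_Collect) (use X in auto)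
    also have "\<dots> = (\<Prod>i<fst v. ennreal (1 / real (card (C i))))"
      using X C(1)
        by (intro prod.cong) (auto simp: emeasure_uniform_count_measure sets_uniform_count_measure)
    finally show "emeasure ?P (cylinder v) = ennreal (\<Prod>i<fst v. 1 / real (card (C i)))"
      by (simp add: prod_ennreal)
    show "cylinder v \<in> sets ?P" unfolding cylinder_def using X by measurable
  qed
  define W where "W i = (\<Union>v\<in>S i. cylinder v)" for i
  have W_sets: "W i \<in> sets ?P" for i unfolding W_def using S(1) cylinder(2)
    by (intro sets.finite_UN) auto
  have W_le: "emeasure ?P (W i) \<le> ennreal (4 * K * r i powr s)" for i
  proof -
    have "emeasure ?P (W i) \<le> (\<Sum>v\<in>S i. emeasure ?P (cylinder v))"
      unfolding W_def using S(1) cylinder(2) by (intro emeasure_subadditive_finite) auto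
    also have "\<dots> = (\<Sum>v\<in>S i. ennreal (\<Prod>i<fst v. 1 / real (card (C i))))"
      using cylinder(1) by (intro sum.cong) auto
    also have "\<dots> = ennreal (\<Sum>v\<in>S i. \<Prod>i<fst v. 1 / real (card (C i)))"
      by (intro sum_ennreal prod_nonneg) auto
    also have "\<dots> \<le> ennreal (4 * K * r i powr s)"
      using S(3)[of i] by (intro ennreal_leI) (simp add: case_prod_unfold)
    finally show ?thesis .
  qed
  have "space ?P \<subseteq> (\<Union>i. W i)"
  proof
    fix c assume c: "c \<in> space ?P"
    then have cC: "\<forall>i. c i \<in> C i" by (simp add: space)
    obtain x where x: "x \<in> A" "x \<in> {0..<1}" "\<forall>i. dg i x = c i" using A[of c] cC by blast
    obtain i where "x \<in> U i" using x cov by auto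
    then have "\<exists>(n, w)\<in>S i. \<forall>i<n. c i = w i" using S(4)[of i] cC x by blast
    then obtain v where v: "v \<in> S i" "\<forall>j<fst v. c j = snd v j" by auto
    then have "c \<in> cylinder v" using c unfolding cylinder_def by simp
    then show "c \<in> (\<Union>i. W i)" using v unfolding W_def by blast
  qed
  then have "emeasure ?P (space ?P) \<le> emeasure ?P (\<Union>i. W i)" using W_sets
    by (intro emeasure_mono) auto
  also have "\<dots> \<le> (\<Sum>i. emeasure ?P (W i))" using W_sets
    by (intro emeasure_subadditive_countably) auto
  also have "\<dots> \<le> (\<Sum>i. ennreal (4 * K * r i powr s))" using W_le by (intro suminf_le) auto
  also have "\<dots> = (\<Sum>i. ennreal (4 * K) * (diam_pow s (U i) + ennreal (e * (1 / 2) ^ Suc i)))"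
    unfolding rs dp using K e by (intro suminf_cong) (simp add: ennreal_mult' flip: ennreal_plus)
  also have "\<dots> = ennreal (4 * K) * ((\<Sum>i. diam_pow s (U i)) + (\<Sum>i. ennreal (e * (1 / 2) ^ Suc i)))"
    by (simp add: ennreal_suminf_cmult suminf_add)
  also have "(\<Sum>i. ennreal (e * (1 / 2) ^ Suc i)) = ennreal e"
    using sums_mult[OF power_half_series, of e] e by (intro suminf_ennreal_eq) auto
  finally have main: "1 \<le> ennreal (4 * K) * ((\<Sum>i. diam_pow s (U i)) + ennreal e)"
    by (simp add: emeasure_space_1)
  show "ennreal (1 / (8 * K)) \<le> (\<Sum>i. diam_pow s (U i))"
  proof (rule ccontr)
    assume "\<not> ?thesis"
    then have less: "(\<Sum>i. diam_pow s (U i)) < ennreal e" by (simp add: e_def not_le)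
    then obtain x where x: "0 \<le> x" "(\<Sum>i. diam_pow s (U i)) = ennreal x"
      by (cases "\<Sum>i. diam_pow s (U i)") auto
    have "x < e" using less x by (simp add: ennreal_less_iff)
    have "ennreal 1 \<le> ennreal (4 * K * (x + e))" using main x e K
      by (simp add: ennreal_mult' flip: ennreal_plus)
    then have "1 \<le> 4 * K * (x + e)" using K x e by (subst (asm) ennreal_le_iff) auto
    also have "\<dots> < 4 * K * (e + e)" using \<open>x < e\<close> K by (intro mult_strict_left_mono) auto
    also have "\<dots> = 1" using K by (simp add: e_def)
    finally show False by simp
  qed
qed

end

section \<open>Times of density \<open>\<theta>\<close>\<close>

text \<open>
  The times at which the Beatty-like sequence \<open>\<lfloor>\<theta> * n\<rfloor>\<close> jumps: exactly \<open>\<lfloor>\<theta> * n\<rfloor>\<close> of them are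
  less than \<open>n\<close>.
\<close>

definition new_time :: "real \<Rightarrow> nat \<Rightarrow> bool" where
  "new_time \<theta> i \<longleftrightarrow> \<lfloor>\<theta> * real i\<rfloor> < \<lfloor>\<theta> * real (Suc i)\<rfloor>"

lemma floor_new_time:
  assumes "0 \<le> \<theta>" "\<theta> \<le> 1"
  shows "\<lfloor>\<theta> * real (Suc n)\<rfloor> = \<lfloor>\<theta> * real n\<rfloor> + (if new_time \<theta> n then 1 else 0)"
proof -
  have "\<lfloor>\<theta> * real n\<rfloor> \<le> \<lfloor>\<theta> * real (Suc n)\<rfloor>"
    using assms by (intro floor_mono mult_left_mono) auto
  moreover have "\<theta> * real (Suc n) \<le> \<theta> * real n + 1" using assms by (simp add: algebra_simps)
  then have "\<lfloor>\<theta> * real (Suc n)\<rfloor> \<le> \<lfloor>\<theta> * real n\<rfloor> + 1" by linarith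
  ultimately show ?thesis by (auto simp: new_time_def)
qed

lemma card_new_times:
  assumes "0 \<le> \<theta>" "\<theta> \<le> 1"
  shows "int (card {i. i < n \<and> new_time \<theta> i}) = \<lfloor>\<theta> * real n\<rfloor>"
proof (induction n)
  case (Suc n)
  have "{i. i < Suc n \<and> new_time \<theta> i} =
      (if new_time \<theta> n then insert n {i. i < n \<and> new_time \<theta> i} else {i. i < n \<and> new_time \<theta> i})"
    by (auto simp: less_Suc_eq)
  then show ?case unfolding floor_new_time[OF assms] using Suc by auto
qed simp

text \<open>
  Every step is charged \<open>b\<close>, also the new times where \<open>M\<close> alone would do; this loses nothing
  essential and makes the bound geometric. The division by \<open>M\<close> pays for rounding \<open>\<theta> * n\<close> down.
\<close>

lemma prod_new_times_ge:
  fixes g :: "nat \<Rightarrow> real"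
  assumes \<theta>: "0 \<le> \<theta>" "\<theta> \<le> 1" and M: "1 \<le> M" and b: "0 < b" "b \<le> 1"
    and new: "\<And>i. new_time \<theta> i \<Longrightarrow> M \<le> g i" and old: "\<And>i. \<not> new_time \<theta> i \<Longrightarrow> b \<le> g i"
  shows "(M powr \<theta> * b) ^ n / M \<le> (\<Prod>i<n. g i)"
proof -
  have g0: "0 < g i" for i using new[of i] old[of i] M b by (cases "new_time \<theta> i") auto
  have "M powr \<lfloor>\<theta> * real n\<rfloor> * b ^ n \<le> (\<Prod>i<n. g i)"
  proof (induction n)
    case (Suc n)
    have "M powr \<lfloor>\<theta> * real (Suc n)\<rfloor> * b ^ Suc n
        = (M powr \<lfloor>\<theta> * real n\<rfloor> * b ^ n) * ((if new_time \<theta> n then M else 1) * b)"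
      unfolding floor_new_time[OF \<theta>] using M by (simp add: powr_add)
    also have "\<dots> \<le> (\<Prod>i<n. g i) * g n"
    proof (intro mult_mono Suc.IH)
      have "M * b \<le> M * 1" using M b by (intro mult_left_mono) auto
      then show "(if new_time \<theta> n then M else 1) * b \<le> g n" using new[of n] old[of n] by auto
    qed (use M b g0 in \<open>auto intro!: prod_nonneg intro: less_imp_le\<close>)
    finally show ?case by simp
  qed simp
  moreover have "(M powr \<theta> * b) ^ n / M \<le> M powr \<lfloor>\<theta> * real n\<rfloor> * b ^ n"
  proof -
    have "(M powr \<theta>) ^ n / M = M powr (\<theta> * real n - 1)"
      using M by (simp add: powr_diff powr_powr[symmetric] powr_realpow)
    also have "\<dots> \<le> M powr \<lfloor>\<theta> * real n\<rfloor>" using M by (intro powr_mono) linarith+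
    finally have "(M powr \<theta>) ^ n / M * b ^ n \<le> M powr \<lfloor>\<theta> * real n\<rfloor> * b ^ n"
      using b by (intro mult_right_mono) auto
    then show ?thesis by (simp add: power_mult_distrib)
  qed
  ultimately show ?thesis by linarith
qed

text \<open>
  The digits at new times are pairwise different, and all other times contribute the single
  digit 1.
\<close>

lemma card_image_new_times:
  fixes c :: "nat \<Rightarrow> nat"
  assumes \<theta>: "0 \<le> \<theta>" "\<theta> \<le> 1" and inj: "inj_on c {i. new_time \<theta> i}"
    and old: "\<And>i. \<not> new_time \<theta> i \<Longrightarrow> c i = 1"
  shows "\<theta> * real n - 1 \<le> real (card (c ` {..<n}))" "real (card (c ` {..<n})) \<le> \<theta> * real n + 1"
proof -
  let ?N = "{i. i < n \<and> new_time \<theta> i}"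
  have card: "card (c ` ?N) = card ?N" by (intro card_image inj_on_subset[OF inj]) auto
  have N: "real (card ?N) = of_int \<lfloor>\<theta> * real n\<rfloor>" by (metis card_new_times[OF \<theta>] of_int_of_nat_eq)
  have "card (c ` ?N) \<le> card (c ` {..<n})" by (intro card_mono) auto
  then show "\<theta> * real n - 1 \<le> real (card (c ` {..<n}))" using card N by linarith
  have "c ` {..<n} \<subseteq> insert 1 (c ` ?N)" using old by auto
  then have "card (c ` {..<n}) \<le> card (insert 1 (c ` ?N))" by (intro card_mono) auto
  also have "\<dots> \<le> Suc (card (c ` ?N))" by (rule card_insert_le_m1) auto
  finally show "real (card (c ` {..<n})) \<le> \<theta> * real n + 1" using card N by linarith
qed

lemma distinct_count_tendsto:
  fixes c :: "nat \<Rightarrow> nat"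
  assumes "\<And>n. \<theta> * real n - 1 \<le> real (card (c ` {..<n}))" "\<And>n. real (card (c ` {..<n})) \<le> \<theta> * real n + 1"
  shows "(\<lambda>n. real (card (c ` {..<n})) / real n) \<longlonglongrightarrow> \<theta>"
proof (rule tendsto_sandwich)
  show "(\<lambda>n. (\<theta> * real n - 1) / real n) \<longlonglongrightarrow> \<theta>" by real_asymp
  show "(\<lambda>n. (\<theta> * real n + 1) / real n) \<longlonglongrightarrow> \<theta>" by real_asymp
qed (use assms in \<open>auto intro!: always_eventually divide_right_mono\<close>)

text \<open>
  An eventually constant sequence has finitely many values, contradicting linear growth of their
  number.
\<close>

lemma not_eventually_constant:
  fixes c :: "nat \<Rightarrow> nat"
  assumes "0 < \<theta>" "\<And>n. \<theta> * real n - 1 \<le> real (card (c ` {..<n}))"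
  shows "\<exists>m\<ge>n. c m \<noteq> c n"
proof (rule ccontr)
  assume "\<not> ?thesis"
  then have const: "\<And>m. n \<le> m \<Longrightarrow> c m = c n" by blast
  obtain N :: nat where "(real n + 2) / \<theta> < real N" using reals_Archimedean2 by blast
  then have N: "real n + 2 < \<theta> * real N" using assms(1) by (simp add: field_simps)
  have "c ` {..<N} \<subseteq> c ` {..n}"
  proof
    fix y assume "y \<in> c ` {..<N}"
    then obtain m where "y = c m" by auto
    then show "y \<in> c ` {..n}" using const[of m] by (cases "m \<le> n") auto
  qed
  then have "card (c ` {..<N}) \<le> card (c ` {..n})" by (intro card_mono) auto
  also have "\<dots> \<le> n + 1" using card_image_le[of "{..n}" c] by simp
  finally show False using assms(2)[of N] N by linarith
qed

section \<open>Rich disjoint blocks of digits\<close>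

lemma powr_le_const_mult_power_2:
  fixes a :: real
  obtains D where "0 < D" "\<And>n. real (Suc n) powr a \<le> D * 2 ^ n"
proof -
  have "(\<lambda>n. real (Suc n) powr a / 2 ^ n) \<longlonglongrightarrow> 0" by real_asymp
  from convergent_imp_Bseq[OF convergentI[OF this]]
  obtain D where "0 < D" "\<And>n. norm (real (Suc n) powr a / 2 ^ n) \<le> D" by (auto elim: BseqE)
  then show ?thesis using that[of D] by (simp add: field_simps)
qed

text \<open>
  The blocks are \<open>B n = {N * (n+1)^(h+1) ..< N * (n+1)^h * (n+2)}\<close>. Such a block has
  \<open>N * (n+1)^h\<close> elements, all less than \<open>2 * N * (n+1)^(h+1)\<close>, and ends before the next one starts.
  Hence \<open>card (B n) * b n powr s\<close> is a constant times
  \<open>N powr (1 - s * \<tau>) * (n+1) powr (h - (h+1) * s * \<tau>)\<close>. As \<open>s * \<tau> < 1\<close>, a large \<open>h\<close> makes the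
  exponent of \<open>n + 1\<close> nonnegative, and then a large \<open>N\<close> makes the product exceed \<open>M\<close>. The digit
  1 is left out of all blocks, because it serves as the filler.
\<close>

lemma disjoint_digit_blocks:
  fixes p :: "nat \<Rightarrow> real"
  assumes c: "0 < c" and p: "\<And>k. 1 \<le> k \<Longrightarrow> c * real k powr (- \<tau>) \<le> p k" and \<tau>: "0 < \<tau>"
    and s: "0 < s" "s < 1" "s * \<tau> < 1"
  obtains B :: "nat \<Rightarrow> nat set" and b :: "nat \<Rightarrow> real" and D :: real where
    "\<And>n. finite (B n)" "\<And>n. B n \<noteq> {}" "\<And>n. B n \<subseteq> {2..}"
    "\<And>n m. n \<noteq> m \<Longrightarrow> B n \<inter> B m = {}"
    "\<And>n. 0 < b n" "\<And>n k. k \<in> B n \<Longrightarrow> b n \<le> p k"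
    "\<And>n. M \<le> real (card (B n)) * b n powr s"
    "0 < D" "\<And>n. b n powr (s - 1) \<le> D * 2 ^ n"
proof -
  obtain h :: nat where "s * \<tau> / (1 - s * \<tau>) < real h" using reals_Archimedean2 by blast
  then have h: "real (Suc h) * (s * \<tau>) \<le> real h" using s by (simp add: field_simps)
  define G where "G = c powr s * 2 powr (- \<tau> * s)"
  have G: "0 < G" using c by (simp add: G_def)
  obtain N :: nat where N': "max 2 ((max 1 (M / G)) powr (1 / (1 - s * \<tau>))) < real N"
    using reals_Archimedean2 by blast
  then have N: "2 \<le> N" by simp
  have "M / G \<le> real N powr (1 - s * \<tau>)"
  proof -
    have "max 1 (M / G) = (max 1 (M / G) powr (1 / (1 - s * \<tau>))) powr (1 - s * \<tau>)"
      using s by (simp add: powr_powr)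
    also have "\<dots> \<le> real N powr (1 - s * \<tau>)" using N' s by (intro powr_mono2) auto
    finally show ?thesis by simp
  qed
  then have NM: "M \<le> G * real N powr (1 - s * \<tau>)" using G by (simp add: field_simps)
  define lo hi where "lo n = N * Suc n ^ h * Suc n" and "hi n = N * Suc n ^ h * Suc (Suc n)" for n
  define B where "B n = {lo n..<hi n}" for n
  define b where "b n = c * (2 * real (lo n)) powr (- \<tau>)" for n
  have lo_ge: "2 \<le> lo n" for n
  proof -
    have "2 * 1 * 1 \<le> N * Suc n ^ h * Suc n" using N by (intro mult_le_mono) auto
    then show ?thesis by (simp add: lo_def)
  qed
  have hi_lo: "hi n = lo n + N * Suc n ^ h" for n by (simp add: hi_def lo_def)
  have width: "0 < N * Suc n ^ h" for n using N by simp
  have "N * Suc n ^ h * 1 \<le> N * Suc n ^ h * Suc n" for n by (intro mult_le_mono) auto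
  then have hi_le: "hi n \<le> 2 * lo n" for n unfolding hi_lo lo_def by (simp add: mult_2)
  have next_block: "hi n \<le> lo m" if "n < m" for n m
    unfolding hi_def lo_def using that by (intro mult_le_mono power_mono) auto
  have disj: "B n \<inter> B m = {}" if "n < m" for n m using next_block[OF that] by (auto simp: B_def)
  have lo_pos: "0 < real (lo n)" for n using lo_ge[of n] by simp
  have card: "real (card (B n)) * b n powr s = G * real N powr (1 - s * \<tau>) * real (Suc n) powr (real h - real (Suc h) * (s * \<tau>))" for n
  proof -
    have lo_real: "real (lo n) = real N * real (Suc n) powr real (Suc h)"
      by (subst powr_realpow) (simp_all add: lo_def algebra_simps)
    have "b n powr s = G * real (lo n) powr (- \<tau> * s)"
      using c by (simp add: b_def G_def powr_mult powr_powr)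
    also have "real (lo n) powr (- \<tau> * s) = real N powr (- \<tau> * s) * real (Suc n) powr (real (Suc h) * (- \<tau> * s))"
      unfolding lo_real by (simp only: powr_mult powr_powr)
    finally have b: "b n powr s = G * (real N powr (- \<tau> * s) * real (Suc n) powr (real (Suc h) * (- \<tau> * s)))" .
    have "real (card (B n)) = real N powr 1 * real (Suc n) powr real h"
      using N by (simp add: B_def hi_lo powr_realpow)
    then have "real (card (B n)) * b n powr s
        = G * (real N powr 1 * real N powr (- \<tau> * s))
          * (real (Suc n) powr real h * real (Suc n) powr (real (Suc h) * (- \<tau> * s)))"
      unfolding b by (simp only: mult_ac)
    also have "\<dots> = G * real N powr (1 + - \<tau> * s) * real (Suc n) powr (real h + real (Suc h) * (- \<tau> * s))"
      by (simp only: powr_add)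
    finally show ?thesis by (simp add: algebra_simps)
  qed
  have weight: "M \<le> real (card (B n)) * b n powr s" for n
  proof -
    have "G * real N powr (1 - s * \<tau>) * 1 \<le> real (card (B n)) * b n powr s"
      unfolding card using G h by (intro mult_left_mono ge_one_powr_ge_zero) auto
    then show ?thesis using NM by simp
  qed
  obtain D where D: "0 < D" "\<And>n. real (Suc n) powr (real (Suc h) * (\<tau> * (1 - s))) \<le> D * 2 ^ n"
    by (rule powr_le_const_mult_power_2) blast
  define E where "E = c powr (s - 1) * (2 * real N) powr (\<tau> * (1 - s))"
  have E: "0 < E" using c N by (simp add: E_def)
  have decay: "b n powr (s - 1) \<le> E * D * 2 ^ n" for n
  proof -
    have "2 * real (lo n) = (2 * real N) * real (Suc n) powr real (Suc h)"
      by (subst powr_realpow) (simp_all add: lo_def algebra_simps)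
    then have "b n powr (s - 1) = c powr (s - 1) * ((2 * real N) * real (Suc n) powr real (Suc h)) powr (\<tau> * (1 - s))"
      using c unfolding b_def by (simp add: powr_mult powr_powr algebra_simps)
    also have "\<dots> = E * real (Suc n) powr (real (Suc h) * (\<tau> * (1 - s)))"
      unfolding E_def by (simp only: powr_mult powr_powr mult_ac)
    also have "\<dots> \<le> E * (D * 2 ^ n)" using D(2)[of n] E by (intro mult_left_mono) auto
    finally show ?thesis by simp
  qed
  have below: "b n \<le> p k" if k: "k \<in> B n" for n k
  proof -
    have k': "2 \<le> k" "k \<le> 2 * lo n" using k lo_ge[of n] hi_le[of n] by (auto simp: B_def)
    have "b n \<le> c * real k powr (- \<tau>)"
      unfolding b_def using k' c \<tau> by (intro mult_left_mono powr_mono2') auto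
    also have "\<dots> \<le> p k" using k' by (intro p) simp
    finally show ?thesis .
  qed
  show ?thesis
  proof (rule that[of B b "E * D"])
    show "B n \<inter> B m = {}" if "n \<noteq> m" for n m
      using disj[of n m] disj[of m n] that by (cases "n < m") auto
    show "B n \<noteq> {}" for n using width[of n] by (simp add: B_def hi_lo)
    show "B n \<subseteq> {2..}" for n using lo_ge[of n] by (auto simp: B_def)
    show "0 < b n" for n using c lo_pos[of n] by (simp add: b_def)
  qed (use weight decay below D E in \<open>auto simp: B_def\<close>)
qed

section \<open>The dimension of the level sets of the digit count\<close>

context full_branch
begin

text \<open>
  \<open>M\<close> is chosen with \<open>M powr \<theta> * (p 1) powr s = 2\<close>: blocks at new times gain at least \<open>M\<close>, fillers
  gain \<open>(p 1) powr s\<close>, and with density \<open>\<theta>\<close> of new times the total gain up to time \<open>n\<close> is of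
  order \<open>2 ^ n\<close>. This dominates \<open>\<beta> n powr (s - 1)\<close>, which grows at most like a constant times
  \<open>2 ^ n\<close> as well.
\<close>

lemma hausdorff_pre_distinct_ratio_pos:
  assumes rv: "regularly_varying p \<rho>" and \<rho>: "1 \<le> \<rho>" and \<theta>: "0 < \<theta>" "\<theta> \<le> 1" and s: "0 < s" "s < 1 / \<rho>"
  shows "0 < hausdorff_pre s \<delta>
    {x \<in> {0..<1}. (\<lambda>n. real (distinct_digits p I n x) / real n) \<longlonglongrightarrow> \<theta>}" (is "0 < hausdorff_pre s \<delta> ?E")
proof -
  have s\<rho>: "s * \<rho> < 1" using s \<rho> by (simp add: field_simps)
  have "s * 1 \<le> s * \<rho>" using s \<rho> by (intro mult_left_mono) auto
  then have s1: "s < 1" using s\<rho> by simp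
  define e where "e = (1 / s - \<rho>) / 2"
  have e: "0 < e" using s\<rho> s by (simp add: e_def field_simps)
  obtain c where c: "0 < c" "\<And>k. 1 \<le> k \<Longrightarrow> c * real k powr (- \<rho> - e) \<le> p k"
    using regularly_varying_powr_bounds[OF p_pos rv e] by metis
  have c': "c * real k powr (- (\<rho> + e)) \<le> p k" if "1 \<le> k" for k using c(2)[OF that] by simp
  have "s * (\<rho> + e) = (s * \<rho> + 1) / 2" using s by (simp add: e_def field_simps)
  then have \<tau>: "0 < \<rho> + e" "s * (\<rho> + e) < 1" using \<rho> e s\<rho> by auto
  obtain \<eta> where "\<eta> < 1" "\<And>k. 1 \<le> k \<Longrightarrow> p k \<le> \<eta>"
    by (rule p_bounded_away_from_1) blast
  then have p1: "0 < p 1" "p 1 < 1" using p_pos[of 1] by fastforce+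
  define M where "M = (2 / p 1 powr s) powr (1 / \<theta>)"
  have p1s: "0 < p 1 powr s" "p 1 powr s \<le> 1" using p1 s by (auto intro!: powr_le1)
  have "1 \<le> 2 / p 1 powr s" using p1s by (simp add: field_simps)
  then have M1: "1 \<le> M" unfolding M_def using \<theta> by (intro ge_one_powr_ge_zero) auto
  have M\<theta>: "M powr \<theta> * p 1 powr s = 2" using \<theta> p1s by (simp add: M_def powr_powr)
  obtain B b D where
      B: "\<And>n. finite (B n)" "\<And>n. B n \<noteq> {}" "\<And>n. B n \<subseteq> {2..}" "\<And>n m. n \<noteq> m \<Longrightarrow> B n \<inter> B m = {}"
    and b: "\<And>n. 0 < b n" "\<And>n k. k \<in> B n \<Longrightarrow> b n \<le> p k"
      "\<And>n. M \<le> real (card (B n)) * b n powr s"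
    and D: "0 < D" "\<And>n. b n powr (s - 1) \<le> D * 2 ^ n"
    by (rule disjoint_digit_blocks[OF c(1) c' \<tau>(1) s(1) s1 \<tau>(2), of M]) blast+
  define C where "C n = (if new_time \<theta> n then B n else {1})" for n
  define \<beta> where "\<beta> n = (if new_time \<theta> n then b n else p 1)" for n
  define K where "K = M * (p 1 powr (s - 1) + D) + 1"
  have K: "1 \<le> K" using M1 D(1) by (simp add: K_def)
  have gain: "\<beta> n powr (s - 1) \<le> K * (\<Prod>i\<le>n. real (card (C i)) * \<beta> i powr s)" for n
  proof -
    have "(M powr \<theta> * p 1 powr s) ^ Suc n / M \<le> (\<Prod>i<Suc n. real (card (C i)) * \<beta> i powr s)"
      using \<theta> M1 p1s b(3) by (intro prod_new_times_ge) (auto simp: C_def \<beta>_def)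
    then have "2 ^ Suc n / M \<le> (\<Prod>i\<le>n. real (card (C i)) * \<beta> i powr s)"
      unfolding M\<theta> lessThan_Suc_atMost .
    moreover have "2 ^ n / M \<le> 2 ^ Suc n / M" using M1 by (intro divide_right_mono) auto
    ultimately have "2 ^ n / M \<le> (\<Prod>i\<le>n. real (card (C i)) * \<beta> i powr s)" by linarith
    then have "K * (2 ^ n / M) \<le> K * (\<Prod>i\<le>n. real (card (C i)) * \<beta> i powr s)"
      using K by (intro mult_left_mono) auto
    moreover have "\<beta> n powr (s - 1) \<le> K * (2 ^ n / M)"
    proof -
      have "p 1 powr (s - 1) * 1 \<le> p 1 powr (s - 1) * 2 ^ n" by (intro mult_left_mono) auto
      then have "\<beta> n powr (s - 1) \<le> p 1 powr (s - 1) * 2 ^ n + D * 2 ^ n"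
        using D(1) D(2)[of n] by (auto simp: \<beta>_def intro: add_increasing add_increasing2)
      also have "\<dots> = M * (p 1 powr (s - 1) + D) * (2 ^ n / M)" using M1 by (simp add: field_simps)
      also have "\<dots> \<le> K * (2 ^ n / M)" using M1 by (intro mult_right_mono) (auto simp: K_def)
      finally show ?thesis .
    qed
    ultimately show ?thesis by linarith
  qed
  have realized: "\<exists>x\<in>?E. x \<in> {0..<1} \<and> (\<forall>i. dg i x = c i)" if cC: "\<And>i. c i \<in> C i" for c
  proof -
    have ge1: "1 \<le> c i" for i using cC[of i] B(3)[of i] by (auto simp: C_def split: if_splits)
    have inj: "inj_on c {i. new_time \<theta> i}"
    proof (rule inj_onI)
      fix i j assume "i \<in> {i. new_time \<theta> i}" "j \<in> {i. new_time \<theta> i}" "c i = c j"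
      then have "c i \<in> B i \<inter> B j" using cC[of i] cC[of j] by (auto simp: C_def)
      then show "i = j" using B(4) by blast
    qed
    have old: "c i = 1" if "\<not> new_time \<theta> i" for i using cC[of i] that by (simp add: C_def)
    note bounds = card_image_new_times[OF less_imp_le[OF \<theta>(1)] \<theta>(2) inj old]
    obtain x where x: "x \<in> {0..<1}" "\<And>i. dg i x = c i"
      using digits_realized[OF ge1 not_eventually_constant[OF \<theta>(1) bounds(1)]] by blast
    have "(\<lambda>n. real (distinct_digits p I n x) / real n) \<longlonglongrightarrow> \<theta>"
      unfolding distinct_digits_eq x(2) by (rule distinct_count_tendsto[OF bounds])
    then show ?thesis using x by blast
  qed
  have "ennreal (1 / (8 * K)) \<le> hausdorff_pre s \<delta> ?E"
  proof (rule hausdorff_pre_digit_blocks[OF _ _ _ _ _ s(1) s1 K gain realized])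
    show "C i \<subseteq> {1..}" for i using B(3)[of i] by (auto simp: C_def subset_eq)
    show "\<beta> i \<le> p k" if "k \<in> C i" for i k using that b(2)
      by (auto simp: C_def \<beta>_def split: if_splits)
  qed (use B b p1 in \<open>auto simp: C_def \<beta>_def\<close>)
  moreover have "0 < ennreal (1 / (8 * K))" using K by simp
  ultimately show ?thesis by (rule less_le_trans[rotated])
qed

end

theorem theorem1:
  fixes p :: "nat \<Rightarrow> real" and \<rho> \<theta> :: real and I :: "nat \<Rightarrow> real set"
  assumes "probability_sequence p"
    and "\<rho> \<ge> 1"
    and "regularly_varying p \<rho>"
    and "interval_partition p I"
    and "0 < \<theta>" and "\<theta> \<le> 1"
  shows "hausdorff_dim {x \<in> {0..<1}.
           (\<lambda>n. real (distinct_digits p I n x) / real n) \<longlonglongrightarrow> \<theta>} = ennreal (1 / \<rho>)"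
    (is "hausdorff_dim ?E = _")
proof -
  interpret full_branch p I using assms(1,4) by unfold_locales
  have \<rho>: "0 < \<rho>" using assms(2) by simp
  show ?thesis
  proof (rule hausdorff_dim_eqI)
    fix s assume s: "1 / \<rho> < s"
    have "0 < 1 / \<rho>" using \<rho> by simp
    then have s0: "0 < s" using s by linarith
    have "\<exists>\<^sub>F n in sequentially. \<theta> / 2 * real n \<le> real (distinct_digits p I n x)" if "x \<in> ?E" for x
    proof -
      have "(\<lambda>n. real (distinct_digits p I n x) / real n) \<longlonglongrightarrow> \<theta>" using that by simp
      then have "\<forall>\<^sub>F n in sequentially. \<theta> / 2 < real (distinct_digits p I n x) / real n"
        using assms(5) by (intro order_tendstoD(1)) auto
      then have "\<forall>\<^sub>F n in sequentially. \<theta> / 2 * real n \<le> real (distinct_digits p I n x)"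
        using eventually_gt_at_top[of 0] by eventually_elim (simp add: field_simps)
      then show ?thesis by (rule eventually_frequently[rotated]) simp
    qed
    then have "hausdorff_pre s \<delta> ?E = 0" if "0 < \<delta>" for \<delta>
      using that s0 assms(5) summable_powr_regularly_varying[OF p_pos assms(3) \<rho> s]
      by (intro hausdorff_pre_many_distinct_digits[of s "\<theta> / 2"]) auto
    then show "hausdorff_measure s ?E = 0"
      by (auto simp: hausdorff_measure_def intro!: SUP_eq_const)
  next
    show "0 < hausdorff_pre s 1 ?E" if "0 < s" "s < 1 / \<rho>" for s
      using hausdorff_pre_distinct_ratio_pos[OF assms(3,2,5,6) that] .
  qed (use \<rho> in auto)
qed

end
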